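(* Let $0<m\le L<\infty$ and let $\mathcal{A}=(A,B,C)$ be an algorithm satisfying the algorithm-form assumption, applied to functions in $Q_{m,L}$, with noise satisfying the noise assumption. Then $$\mathrm{rate}(\mathcal{A},Q_{m,L})=\sup_{q\in[m,L]}\rho(A+qBC),$$ where $\rho(\cdot)$ denotes the spectral radius. If $\mathrm{rate}(\mathcal{A},Q_{m,L})<1$, then the algorithm has finite sensitivity given by $$\mathrm{sens}(\mathcal{A},Q_{m,L})=\sup_{q\in[m,L]}\sqrt{B^{\mathsf T}P_qB},$$ where $P_q$ is the unique solution to the linear equation $$(A+qBC)^{\mathsf T}P_q(A+qBC)-P_q+C^{\mathsf T}C=0.$$
   Context: Points of $\mathbb{R}^d$ are written as row vectors in $\mathbb{R}^{1\times d}$, $\nabla f:\mathbb{R}^{1\times d}\to\mathbb{R}^{1\times d}$, and $\|\cdot\|$ is the Frobenius norm. Function class $Q_{m,L}$: functions $f:\mathbb{R}^d\to\mathbb{R}$ such that for some $f^\star\in\mathbb{R}$, $y^\star\in\mathbb{R}^d$ and symmetric $Q\in\mathbb{R}^{d\times d}$ with all eigenvalues in $[m,L]$, $f(y)=\frac12(y-y^\star)Q(y-y^\star)^{\mathsf T}+f^\star$ ($y$ a row vector). $y^\star$ is the unique minimizer. Algorithms: $\mathcal{A}=(A,B,C)$ with $A\in\mathbb{R}^{n\times n}$, $B\in\mathbb{R}^{n\times1}$, $C\in\mathbb{R}^{1\times n}$ denotes the iteration $\xi^{t+1}=A\xi^t+B(u^t+w^t)$, $y^t=C\xi^t$, $u^t=\nabla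 f(y^t)$, where $\xi^t\in\mathbb{R}^{n\times d}$ is the state and $w^t\in\mathbb{R}^{1\times d}$ the noise. Algorithm-form assumption: $A$ has an eigenvalue at $1$, and the associated eigenvector $v\in\mathbb{R}^n$ satisfies $Cv\ne0$. Consequently there is a fixed point $\xi^\star$ with $\xi^\star=A\xi^\star$, $y^\star=C\xi^\star$. Convergence rate (computed with $w^t=0$ for all $t$): for a function class $\mathcal{F}$, $$\mathrm{rate}(\mathcal{A},\mathcal{F})=\inf\Bigl\{r>0:\ \sup_{f\in\mathcal{F}}\sup_{\xi^0\in\mathbb{R}^{n\times d}}\sup_{t\ge0}\frac{\|\xi^t-\xi^\star\|}{r^t\|\xi^0-\xi^\star\|}<\infty\Bigr\}.$$ Noise assumption (with parameter $\sigma>0$): the joint distribution $\mathbb{P}$ of $w^0,w^1,\dots$ lies in $\mathcal{P}_\sigma$, the set of all joint distributions for which the $w^t$ are independent across $t$ (not necessarily identically distributed), $\mathbb{E}\,w^t=0$, and $\mathbb{E}\|w^t\|^2\le\sigma^2$ for all $t$. Sensitivity: $$\mathrm{sens}(\mathcal{A},\mathcal{F})=\sup_{f\in\mathcal{F}}\sup_{\xi^0\in\mathbb{R}^{n\times d}}\sup_{\mathbb{P}\in\mathcal{P}_\sigma}\limsup_{T\to\infty}\sqrt{\mathbb{E}_{w\sim\mathbb{P}}\frac{1}{\sigma^2T}\sum_{t=0}^{T-1}\|y^t-y^\star\|^2}.$$ *)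

theory Defs
  imports "HOL-Probability.Probability"
begin

(* Points of R^d are row vectors, i.e. 1 x d matrices of type real^'d^1; an n x d matrix has
   type real^'d^'n.  The norm of these types is the L2 norm of the L2 norms of the rows,
   i.e. the Frobenius norm, and their inner product is the Frobenius inner product. *)

definition eigenvals :: "'a::field^'n^'n \<Rightarrow> 'a set" where
  "eigenvals M = {k. \<exists>v. v \<noteq> 0 \<and> M *v v = k *s v}"

(* The eigenvalues are taken over the complex numbers. *)
definition spec_radius :: "real^'n^'n \<Rightarrow> real" where
  "spec_radius M = Max (cmod ` eigenvals (map_matrix complex_of_real M))"

(* The product of the 1 x d, d x d and d x 1 matrices is a 1 x 1 matrix, read as a scalar. *)
definition quad_class :: "real \<Rightarrow> real \<Rightarrow> (real^'d^1 \<Rightarrow> real) set" where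
  "quad_class m L = {f. \<exists>fstar ystar (Q :: real^'d^'d).
     transpose Q = Q \<and> eigenvals Q \<subseteq> {m..L} \<and>
     (\<forall>y. f y = 1/2 * ((y - ystar) ** Q ** transpose (y - ystar)) $ 1 $ 1 + fstar)}"

definition gradient :: "('a::real_inner \<Rightarrow> real) \<Rightarrow> 'a \<Rightarrow> 'a" where
  "gradient f x = (THE g. GDERIV f x :> g)"

definition alg_form :: "real^'n^'n \<Rightarrow> real^'n^1 \<Rightarrow> bool" where
  "alg_form A C \<longleftrightarrow> (\<exists>v. v \<noteq> 0 \<and> A *v v = v \<and> C *v v \<noteq> 0)"

primrec state :: "real^'n^'n \<Rightarrow> real^1^'n \<Rightarrow> real^'n^1 \<Rightarrow> (real^'d^1 \<Rightarrow> real)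
    \<Rightarrow> (nat \<Rightarrow> real^'d^1) \<Rightarrow> real^'d^'n \<Rightarrow> nat \<Rightarrow> real^'d^'n" where
  "state A B C f w x0 0 = x0"
| "state A B C f w x0 (Suc t) =
     A ** state A B C f w x0 t + B ** (gradient f (C ** state A B C f w x0 t) + w t)"

definition opt :: "('a \<Rightarrow> real) \<Rightarrow> 'a" where
  "opt f = arg_min f (\<lambda>_. True)"

(* If the eigenspace of A at 1 has dimension above one, several fixed points x satisfy
   C ** x = opt f.  One of them is chosen; x(t) - fixpt obeys the same linear recursion
   for each of them. *)
definition fixpt :: "real^'n^'n \<Rightarrow> real^'n^1 \<Rightarrow> (real^'d^1 \<Rightarrow> real) \<Rightarrow> real^'d^'n" where
  "fixpt A C f = (SOME x. x = A ** x \<and> opt f = C ** x)"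

(* Initial states at the fixed point, where the quotient is 0/0, are left out.  The infimum
   is taken in ereal, so that it is infinite if no r qualifies. *)
definition rate :: "real^'n^'n \<Rightarrow> real^1^'n \<Rightarrow> real^'n^1 \<Rightarrow> (real^'d^1 \<Rightarrow> real) set \<Rightarrow> ereal" where
  "rate A B C F = (INF r \<in> {r::real. r > 0 \<and>
     (SUP f \<in> F. SUP x0 \<in> - {fixpt A C f}. SUP t.
        ereal (norm (state A B C f (\<lambda>_. 0) x0 t - fixpt A C f)
               / (r ^ t * norm (x0 - fixpt A C f)))) < \<infinity>}. ereal r)"

(* Joint distributions of the noise sequence, as probability measures on the space of
   sequences; the coordinate maps are the noise variables. *)
definition noise_laws :: "real \<Rightarrow> (nat \<Rightarrow> real^'d^1) measure set" where
  "noise_laws \<sigma> = {P. prob_space P \<and> sets P = sets (\<Pi>\<^sub>M t\<in>UNIV. borel) \<and>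
     prob_space.indep_vars P (\<lambda>_. borel) (\<lambda>t w. w t) UNIV \<and>
     (\<forall>t. integrable P (\<lambda>w. w t) \<and> (\<integral>w. w t \<partial>P) = 0) \<and>
     (\<forall>t. integrable P (\<lambda>w. (norm (w t))\<^sup>2) \<and> (\<integral>w. (norm (w t))\<^sup>2 \<partial>P) \<le> \<sigma>\<^sup>2)}"

(* For f in quad_class the gradient is affine, so the integrand below is integrable under
   every law in noise_laws and the Bochner integral is the expectation. *)
definition sens :: "real \<Rightarrow> real^'n^'n \<Rightarrow> real^1^'n \<Rightarrow> real^'n^1
    \<Rightarrow> (real^'d^1 \<Rightarrow> real) set \<Rightarrow> ereal" where
  "sens \<sigma> A B C F = (SUP f \<in> F. SUP x0. SUP P \<in> noise_laws \<sigma>.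
     limsup (\<lambda>T. ereal (sqrt (\<integral>w. 1 / (\<sigma>\<^sup>2 * real T) *
       (\<Sum>t<T. (norm (C ** state A B C f w x0 t - opt f))\<^sup>2) \<partial>P))))"

definition lyap_eq :: "real^'n^'n \<Rightarrow> real^1^'n \<Rightarrow> real^'n^1 \<Rightarrow> real \<Rightarrow> real^'n^'n \<Rightarrow> bool" where
  "lyap_eq A B C q P \<longleftrightarrow>
     transpose (A + q *\<^sub>R (B ** C)) ** P ** (A + q *\<^sub>R (B ** C)) - P + transpose C ** C = 0"

end

theory Submission
  imports Defs "HOL-Computational_Algebra.Fundamental_Theorem_Algebra"
begin

text \<open>
  In an orthonormal eigenbasis of the Hessian \<open>Q\<close> the error recursion decouples: along an eigenvector
  with eigenvalue \<open>q\<close> it is the linear system with matrix \<open>M\<^sub>q = A + q B C\<close>. For the rate,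
  powers of a matrix whose eigenvalues have modulus below \<open>r\<close> are \<open>O(r\<^sup>t)\<close>, uniformly for
  \<open>q\<close> in the compact interval; conversely \<open>Q = q I\<close> exposes every single \<open>M\<^sub>q\<close>.
  For the sensitivity, independence removes all cross terms, so the energy of the output is the convolution
  of the noise variances with the squared impulse response \<open>(C M\<^sub>q\<^sup>k B)\<^sup>2\<close>, whose sum is
  \<open>B\<^sup>T P\<^sub>q B\<close>. The bound is approached by noise of full variance \<open>\<sigma>\<^sup>2\<close> started at the fixed
  point.
\<close>

section \<open>Growth of matrix powers\<close>

text \<open>Continuity of the spectral radius is never invoked. The growth constant of a single
  matrix is not controlled as \<open>q\<close> varies, whereas
  \<open>norm (mat_pow M k) < r ^ k\<close> for one fixed \<open>k > 0\<close> is an open condition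
  on \<open>M\<close> and already governs all later powers; a finite subcover then yields one
  constant for the whole interval. Jordan form is likewise avoided, by induction over the linear
  factors of an annihilating polynomial. For the sensitivity, the obstacle is that one
  \<open>Q\<close> may have several eigenvalues, and that the noise may spread its variance over the
  eigendirections at will, with correlations between directions at a given time. The squared norm is
  a sum over directions, so these correlations never enter, and the directional variances add up to
  at most \<sigma>^2. The energy is therefore governed by the worst eigenvalue of \<open>Q\<close>,
  which is why a supremum over scalars \<open>q\<close> suffices. The initial error has finite total
  output energy and disappears in the time average.\<close>

primrec mat_pow :: "'a::semiring_1^'n^'n \<Rightarrow> nat \<Rightarrow> 'a^'n^'n" where
  "mat_pow M 0 = mat 1"
| "mat_pow M (Suc t) = M ** mat_pow M t"

lemma mat_pow_add: "mat_pow M (s + t) = mat_pow M s ** mat_pow M t"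
  by (induction s) (simp_all add: matrix_mul_assoc)

lemma mat_pow_Suc2: "mat_pow M (Suc t) = mat_pow M t ** M"
  using mat_pow_add[of M t 1] by simp

lemma mat_pow_mult: "mat_pow M (s * t) = mat_pow (mat_pow M s) t"
  by (induction t) (simp_all add: mat_pow_add add.commute)

lemma norm_vector_smult:
  fixes x :: "'a::real_normed_field^'n"
  shows "norm (c *s x) = norm c * norm x"
  by (simp add: norm_vec_def L2_set_def norm_mult power_mult_distrib
      flip: sum_distrib_left real_sqrt_mult)
     (simp add: real_sqrt_mult)

lemma norm_axis_eq: "norm (axis j a :: 'a::real_normed_vector^'n) = norm a"
proof -
  have "norm (axis j a :: 'a^'n) = sqrt (\<Sum>k\<in>UNIV. if k = j then (norm a)\<^sup>2 else 0)"
    unfolding norm_vec_def L2_set_def by (intro arg_cong[of _ _ sqrt] sum.cong) (auto simp: axis_def)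
  then show ?thesis
    by simp
qed

text \<open>Growth is first estimated for the orbit of a single vector; applied to the unit vectors,
  this inequality turns such estimates into bounds on the matrix norm.\<close>

lemma norm_le_sum_columns:
  fixes X :: "'a::real_normed_field^'n^'m"
  shows "norm X \<le> (\<Sum>j\<in>UNIV. norm (X *v axis j 1))"
proof -
  have "(\<Sum>j\<in>UNIV. \<chi> i. axis j (X $ i $ j)) $ i $ k = X $ i $ k" for i k
    by (simp add: axis_def)
  then have "norm X = norm (\<Sum>j\<in>UNIV. (\<chi> i. axis j (X $ i $ j)) :: 'a^'n^'m)"
    by (intro arg_cong[of _ _ norm]) (simp add: vec_eq_iff)
  also have "\<dots> \<le> (\<Sum>j\<in>UNIV. norm ((\<chi> i. axis j (X $ i $ j)) :: 'a^'n^'m))"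
    by (rule norm_sum)
  also have "\<dots> = (\<Sum>j\<in>UNIV. norm (X *v axis j 1))"
  proof (rule sum.cong[OF refl])
    fix j
    have "(X *v axis j 1) $ i = X $ i $ j" for i
      by (simp add: matrix_vector_mult_def axis_def if_distrib cong: if_cong)
    then show "norm ((\<chi> i. axis j (X $ i $ j)) :: 'a^'n^'m) = norm (X *v axis j 1)"
      by (simp add: norm_vec_def[of "X *v axis j 1"]
          norm_vec_def[of "(\<chi> i. axis j (X $ i $ j)) :: 'a^'n^'m"] norm_axis_eq)
  qed
  finally show ?thesis .
qed

lemma norm_matrix_vector_mult_le:
  fixes X :: "real^'n^'m"
  shows "norm (X *v v) \<le> norm X * norm v"
proof -
  have "(norm (X *v v))\<^sup>2 = (\<Sum>i\<in>UNIV. (X $ i \<bullet> v)\<^sup>2)"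
    by (simp add: norm_vec_def[of "X *v v"] L2_set_def sum_nonneg matrix_vector_mul_component)
  also have "\<dots> \<le> (\<Sum>i\<in>UNIV. (norm (X $ i) * norm v)\<^sup>2)"
    by (intro sum_mono) (metis Cauchy_Schwarz_ineq2 abs_le_square_iff abs_mult abs_norm_cancel)
  also have "\<dots> = (norm X * norm v)\<^sup>2"
    by (simp add: norm_vec_def[of X] L2_set_def sum_nonneg power_mult_distrib sum_distrib_right)
  finally show ?thesis
    by (simp add: power2_le_iff_abs_le)
qed

lemma norm_transpose: "norm (transpose X) = norm (X :: real^'n^'m)"
  by (simp add: norm_vec_def L2_set_def transpose_def sum_nonneg) (rule sum.swap)

lemma norm_matrix_mult_le:
  fixes X :: "real^'n^'m" and Y :: "real^'k^'n"
  shows "norm (X ** Y) \<le> norm X * norm Y"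
proof -
  have row: "(X ** Y) $ i = transpose Y *v (X $ i)" for i
    by (simp add: vec_eq_iff matrix_matrix_mult_def matrix_vector_mult_def transpose_def mult.commute)
  have "(norm (X ** Y))\<^sup>2 = (\<Sum>i\<in>UNIV. (norm (transpose Y *v (X $ i)))\<^sup>2)"
    by (simp add: norm_vec_def[of "X ** Y"] L2_set_def sum_nonneg row)
  also have "\<dots> \<le> (\<Sum>i\<in>UNIV. (norm Y * norm (X $ i))\<^sup>2)"
    by (intro sum_mono power_mono norm_ge_zero) (metis norm_matrix_vector_mult_le norm_transpose)
  also have "\<dots> = (norm X * norm Y)\<^sup>2"
    by (simp add: norm_vec_def[of X] L2_set_def sum_nonneg power_mult_distrib sum_distrib_left mult.commute)
  finally show ?thesis
    by (simp add: power2_le_iff_abs_le)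
qed

section \<open>Polynomials in a matrix acting on a vector, and eigenvalues\<close>

definition poly_mat_vec :: "'a::field^'n^'n \<Rightarrow> 'a poly \<Rightarrow> 'a^'n \<Rightarrow> 'a^'n" where
  "poly_mat_vec M p v = (\<Sum>i\<le>degree p. coeff p i *s (mat_pow M i *v v))"

lemma poly_mat_vec_altdef:
  "degree p \<le> n \<Longrightarrow> poly_mat_vec M p v = (\<Sum>i\<le>n. coeff p i *s (mat_pow M i *v v))"
  unfolding poly_mat_vec_def
  by (rule sum.mono_neutral_left) (auto simp: coeff_eq_0)

text \<open>Multiplying \<open>q\<close> by the variable shifts the powers of \<open>M\<close> by
  one, so it amounts to applying \<open>q\<close> to \<open>M *v v\<close>. This peels one root off
  a polynomial and is the engine of both inductions on the degree below.\<close>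

lemma poly_mat_vec_linear_factor:
  "poly_mat_vec M ([:- c, 1:] * q) v = poly_mat_vec M q (M *v v - c *s v)"
proof -
  define n where "n = Suc (degree q)"
  have "degree ([:- c, 1:] * q) \<le> n"
    unfolding n_def by (rule order_trans[OF degree_mult_le]) simp
  moreover have "degree (pCons 0 q) \<le> n" "degree (smult c q) \<le> n"
    by (auto simp: n_def degree_pCons_eq_if)
  moreover have "[:- c, 1:] * q = pCons 0 q - smult c q"
    by simp
  ultimately have "poly_mat_vec M ([:- c, 1:] * q) v
      = poly_mat_vec M (pCons 0 q) v - poly_mat_vec M (smult c q) v"
    by (simp add: poly_mat_vec_altdef[of _ n] vec.scale_left_diff_distrib sum_subtractf)
  also have "poly_mat_vec M (pCons 0 q) v = poly_mat_vec M q (M *v v)"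
    unfolding poly_mat_vec_altdef[OF \<open>degree (pCons 0 q) \<le> n\<close>]
    by (simp add: n_def sum.atMost_Suc_shift poly_mat_vec_def mat_pow_Suc2 matrix_vector_mul_assoc
        del: mat_pow.simps(2) sum.atMost_Suc)
  also have "poly_mat_vec M (smult c q) v = poly_mat_vec M q (c *s v)"
    by (simp add: poly_mat_vec_altdef[of _ n] n_def vec.scale vec.scale_scale mult.commute del: sum.atMost_Suc)
  finally show ?thesis
    by (simp add: poly_mat_vec_def matrix_vector_mult_diff_distrib vec.scale_right_diff_distrib sum_subtractf)
qed

lemma matrix_vector_mult_sum_right: "M *v (\<Sum>i\<in>I. f i) = (\<Sum>i\<in>I. M *v f i)"
  for M :: "'a::field^'n^'m"
  by (rule vec.sum)

lemma mat_pow_commute: "mat_pow M t ** M = M ** mat_pow M t"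
  by (metis mat_pow.simps(2) mat_pow_Suc2)

lemma poly_mat_vec_commute: "poly_mat_vec M q (M *v v) = M *v poly_mat_vec M q v"
  by (simp add: poly_mat_vec_def matrix_vector_mult_sum_right vec.scale matrix_vector_mul_assoc mat_pow_commute)

lemma poly_mat_vec_scale: "poly_mat_vec M q (c *s v) = c *s poly_mat_vec M q v"
  by (simp add: poly_mat_vec_def vec.scale vec.scale_sum_right vec.scale_scale mult.commute)

lemma poly_mat_vec_diff: "poly_mat_vec M q (v - w) = poly_mat_vec M q v - poly_mat_vec M q w"
  by (simp add: poly_mat_vec_def matrix_vector_mult_diff_distrib vec.scale_right_diff_distrib sum_subtractf)

lemma poly_mat_vec_eigenvector:
  assumes "M *v v = k *s v"
  shows "poly_mat_vec M p v = poly p k *s v"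
proof -
  have "mat_pow M i *v v = k ^ i *s v" for i
    by (induction i) (simp_all add: matrix_vector_mul_assoc[symmetric] vec.scale assms vec.scale_scale mult.commute)
  then show ?thesis
    by (simp add: poly_mat_vec_def poly_altdef vec.scale_sum_left)
qed

text \<open>A dimension count: more powers than the real dimension of the matrix space cannot be
  linearly independent. The degree bound of Cayley-Hamilton is irrelevant here, only existence
  matters.\<close>

lemma annihilating_poly:
  fixes M :: "complex^'n^'n"
  obtains p where "p \<noteq> 0" "\<And>v. poly_mat_vec M p v = 0"
proof -
  define N where "N = DIM(complex^'n^'n)"
  have "\<exists>c :: nat \<Rightarrow> real. (\<exists>i\<le>N. c i \<noteq> 0) \<and> (\<Sum>i\<le>N. c i *\<^sub>R mat_pow M i) = 0"
  \<comment> \<open>Linear dependence concerns the set of powers, in which repeated powers are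
    merged. If two powers coincide, their difference is itself the relation sought.\<close>
  proof (cases "inj_on (mat_pow M) {..N}")
    case True
    then have "card (mat_pow M ` {..N}) = Suc N"
      by (simp add: card_image)
    then have "dependent (mat_pow M ` {..N})"
      using independent_bound[of "mat_pow M ` {..N}"] by (auto simp: N_def)
    then obtain u where u: "\<exists>X\<in>mat_pow M ` {..N}. u X \<noteq> 0" "(\<Sum>X\<in>mat_pow M ` {..N}. u X *\<^sub>R X) = 0"
      by (auto simp: real_vector.dependent_finite)
    then show ?thesis
      using sum.reindex[OF True, of "\<lambda>X. u X *\<^sub>R X"] by (intro exI[of _ "\<lambda>i. u (mat_pow M i)"]) auto
  next
    case False
    then obtain i j where ij: "i \<le> N" "j \<le> N" "i \<noteq> j" "mat_pow M i = mat_pow M j"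
      by (auto simp: inj_on_def)
    define c where "c k = (if k = i then 1 else 0) - (if k = j then 1 else 0 :: real)" for k
    have "(\<Sum>k\<le>N. c k *\<^sub>R mat_pow M k)
        = (\<Sum>k\<le>N. if k = i then mat_pow M k else 0) - (\<Sum>k\<le>N. if k = j then mat_pow M k else 0)"
      unfolding sum_subtractf[symmetric] by (rule sum.cong) (auto simp: c_def)
    also have "\<dots> = 0"
      using ij by simp
    finally show ?thesis
      using ij by (intro exI[of _ c] conjI exI[of _ i]) (auto simp: c_def)
  qed
  then obtain c :: "nat \<Rightarrow> real" and i where c: "i \<le> N" "c i \<noteq> 0" "(\<Sum>i\<le>N. c i *\<^sub>R mat_pow M i) = 0"
    by blast
  define p where "p = (\<Sum>i\<le>N. monom (complex_of_real (c i)) i)"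
  have coeff: "coeff p j = (if j \<le> N then complex_of_real (c j) else 0)" for j
    by (simp add: p_def coeff_sum if_distrib[of "\<lambda>x. x = _"])
  have "p \<noteq> 0"
    using c coeff[of i] by auto
  moreover have "poly_mat_vec M p v = 0" for v
  proof -
    have "degree p \<le> N"
      by (rule degree_le) (simp add: coeff)
    then have "poly_mat_vec M p v = (\<Sum>i\<le>N. (c i *\<^sub>R mat_pow M i) *v v)"
      by (simp add: poly_mat_vec_altdef[of _ N] coeff vec_eq_iff matrix_vector_mult_def
          sum_distrib_left mult.assoc)
        (simp add: scaleR_conv_of_real mult.assoc)
    also have "\<dots> = (\<Sum>i\<le>N. c i *\<^sub>R mat_pow M i) *v v"
      by (induction N) (simp_all add: matrix_vector_mult_add_rdistrib)
    finally show ?thesis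
      by (simp add: c)
  qed
  ultimately show ?thesis
    by (rule that)
qed

text \<open>An annihilating polynomial vanishes at every eigenvalue. Together with nonemptiness this
  makes the \<open>Max\<close> in \<open>spec_radius\<close> meaningful.\<close>

lemma finite_eigenvals: "finite (eigenvals (M :: complex^'n^'n))"
proof -
  obtain p where p: "p \<noteq> 0" "\<And>v. poly_mat_vec M p v = 0"
    using annihilating_poly by blast
  have "eigenvals M \<subseteq> {k. poly p k = 0}"
    using p(2) poly_mat_vec_eigenvector[of M _ _ p] by (fastforce simp: eigenvals_def)
  then show ?thesis
    using poly_roots_finite[OF p(1)] finite_subset by blast
qed

lemma not_eigenvalD: "c \<notin> eigenvals M \<Longrightarrow> M *v x - c *s x = 0 \<Longrightarrow> x = 0"
  by (auto simp: eigenvals_def)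

text \<open>Induction over the factors of a polynomial annihilating the one vector \<open>v\<close>.
  Splitting off a root \<open>c\<close> leaves \<open>w\<close>, the image of \<open>v\<close> under
  \<open>M - c\<close>, annihilated by the quotient \<open>q\<close>. If \<open>c\<close> is no
  eigenvalue, \<open>q\<close> already annihilates \<open>v\<close>. Otherwise the orbit of
  \<open>v\<close> satisfies a first-order recursion with factor \<open>c\<close> and forcing of
  order \<open>r ^ t\<close>; since \<open>cmod c < r\<close> strictly, no polynomial factor in
  \<open>t\<close> arises.\<close>

lemma mat_pow_growth_aux:
  fixes M :: "complex^'n^'n"
  assumes r: "0 < r" and eig: "\<And>k. k \<in> eigenvals M \<Longrightarrow> cmod k < r"
  shows "p \<noteq> 0 \<Longrightarrow> poly_mat_vec M p v = 0 \<Longrightarrow> \<exists>K. \<forall>t. norm (mat_pow M t *v v) \<le> K * r ^ t"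
proof (induction "degree p" arbitrary: p v)
  case 0
  then obtain a where "p = [:a:]" "a \<noteq> 0"
    by (metis degree_eq_zeroE pCons_0_0)
  with 0 have "v = 0"
    by (simp add: poly_mat_vec_def)
  then show ?case
    by (intro exI[of _ 0]) simp
next
  case (Suc n)
  then have "\<not> constant (poly p)"
    by (simp add: constant_degree)
  then obtain c where "poly p c = 0"
    using fundamental_theorem_of_algebra by blast
  then obtain q where pq: "p = [:- c, 1:] * q"
    by (auto simp: poly_eq_0_iff_dvd)
  with Suc have q: "q \<noteq> 0" "n = degree q"
    by (auto simp: degree_mult_eq simp del: mult_pCons_left)
  define w where "w = M *v v - c *s v"
  have qw: "poly_mat_vec M q w = 0"
    using Suc.prems(2) by (simp add: pq poly_mat_vec_linear_factor w_def del: mult_pCons_left)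
  obtain K where K: "\<And>t. norm (mat_pow M t *v w) \<le> K * r ^ t"
    using Suc.hyps(1)[OF q(2) q(1) qw] by blast
  show ?case
  proof (cases "c \<in> eigenvals M")
    case False
    have "M *v poly_mat_vec M q v - c *s poly_mat_vec M q v = 0"
      using qw by (simp add: w_def poly_mat_vec_diff poly_mat_vec_commute poly_mat_vec_scale)
    then show ?thesis
      using Suc.hyps(1)[OF q(2) q(1)] not_eigenvalD[OF False] by blast
  next
    case True
    then have c: "cmod c < r"
      by (rule eig)
    \<comment> \<open>The first entry covers \<open>t = 0\<close>; the second gives
      \<open>cmod c * K' + K \<le> K' * r\<close>, which closes the induction step.\<close>
    define K' where "K' = max (norm v) (K / (r - cmod c))"
    have K': "K \<le> K' * (r - cmod c)"
      using c by (simp add: K'_def flip: pos_divide_le_eq)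
    have "norm (mat_pow M t *v v) \<le> K' * r ^ t" for t
    proof (induction t)
      case 0
      show ?case
        by (simp add: K'_def)
    next
      case (Suc t)
      have "mat_pow M (Suc t) *v v = c *s (mat_pow M t *v v) + mat_pow M t *v w"
        by (simp add: w_def mat_pow_Suc2 matrix_vector_mult_diff_distrib vec.scale
            flip: matrix_vector_mul_assoc del: mat_pow.simps)
      then have "norm (mat_pow M (Suc t) *v v) \<le> cmod c * norm (mat_pow M t *v v) + norm (mat_pow M t *v w)"
        by (metis norm_triangle_ineq norm_vector_smult)
      also have "\<dots> \<le> cmod c * (K' * r ^ t) + K' * (r - cmod c) * r ^ t"
        using Suc K[of t] K' r by (intro add_mono mult_left_mono) (auto intro: order_trans)
      also have "\<dots> = K' * r ^ Suc t"
        by (simp add: algebra_simps)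
      finally show ?case .
    qed
    then show ?thesis
      by blast
  qed
qed

text \<open>Without eigenvalues every factor \<open>M - c\<close> is injective, so a nonzero
  polynomial in \<open>M\<close> could only annihilate the zero vector, against the existence of an
  annihilating polynomial.\<close>

lemma eigenvals_nonempty: "eigenvals (M :: complex^'n^'n) \<noteq> {}"
proof
  assume empty: "eigenvals M = {}"
  have *: "v = 0" if "p \<noteq> 0" "poly_mat_vec M p v = 0" for p :: "complex poly" and v
    using that
  proof (induction "degree p" arbitrary: p v)
    case 0
    then obtain a where "p = [:a:]" "a \<noteq> 0"
      by (metis degree_eq_zeroE pCons_0_0)
    with 0 show ?case
      by (simp add: poly_mat_vec_def)
  next
    case (Suc n)
    then have "\<not> constant (poly p)"
      by (simp add: constant_degree)
    then obtain c where "poly p c = 0"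
      using fundamental_theorem_of_algebra by blast
    then obtain q where pq: "p = [:- c, 1:] * q"
      by (auto simp: poly_eq_0_iff_dvd)
    with Suc have q: "q \<noteq> 0" "n = degree q"
      by (auto simp: degree_mult_eq simp del: mult_pCons_left)
    have "poly_mat_vec M q (M *v v - c *s v) = 0"
      using Suc.prems(2) by (simp add: pq poly_mat_vec_linear_factor del: mult_pCons_left)
    then have "M *v v - c *s v = 0"
      by (rule Suc.hyps(1)[OF q(2) q(1)])
    then show ?case
      by (rule not_eigenvalD[rotated]) (simp add: empty)
  qed
  obtain p where p: "p \<noteq> 0" "\<And>v. poly_mat_vec M p v = 0"
    using annihilating_poly by blast
  have "(1 :: complex^'n) = 0"
    by (rule *[OF p])
  then show False
    by simp
qed

section \<open>Spectral radius and power growth of one real matrix\<close>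

lemma map_matrix_of_real_mult_vector:
  "map_matrix complex_of_real M *v (\<chi> i. complex_of_real (v $ i)) = (\<chi> i. complex_of_real ((M *v v) $ i))"
  by (simp add: vec_eq_iff matrix_vector_mult_def)

lemma map_matrix_of_real_mult:
  "map_matrix complex_of_real (M ** N) = map_matrix complex_of_real M ** map_matrix complex_of_real N"
  by (simp add: vec_eq_iff matrix_matrix_mult_def)

lemma mat_pow_of_real:
  "mat_pow (map_matrix complex_of_real M) t = map_matrix complex_of_real (mat_pow M t)"
proof (induction t)
  case 0
  show ?case by (simp add: vec_eq_iff mat_def)
qed (simp add: map_matrix_of_real_mult)

lemma mat_pow_growth:
  fixes M :: "real^'n^'n"
  assumes "spec_radius M < r"
  obtains K where "\<And>t. norm (mat_pow M t) \<le> K * r ^ t"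
proof -
  let ?M = "map_matrix complex_of_real M"
  have eig: "cmod k < r" if "k \<in> eigenvals ?M" for k
    using that assms finite_eigenvals[of ?M] eigenvals_nonempty[of ?M]
    by (simp add: spec_radius_def Max_less_iff)
  \<comment> \<open>Some eigenvalue exists, and its modulus lies in the interval from 0 to below
    \<open>r\<close>.\<close>
  then have r: "0 < r"
    using eigenvals_nonempty[of ?M] norm_ge_zero order_le_less_trans by blast
  obtain p where p: "p \<noteq> 0" "\<And>v. poly_mat_vec ?M p v = 0"
    using annihilating_poly by blast
  have "\<exists>K. \<forall>t. norm (mat_pow M t *v v) \<le> K * r ^ t" for v
  proof -
    obtain K where "\<And>t. norm (mat_pow ?M t *v (\<chi> i. complex_of_real (v $ i))) \<le> K * r ^ t"
      using mat_pow_growth_aux[OF r eig p] by blast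
    moreover have "norm (\<chi> i. complex_of_real (x $ i)) = norm x" for x :: "real^'n"
      by (simp add: norm_vec_def)
    ultimately show ?thesis
      unfolding mat_pow_of_real map_matrix_of_real_mult_vector by metis
  qed
  then obtain K where K: "\<And>v t. norm (mat_pow M t *v v) \<le> K v * r ^ t"
    by metis
  have "norm (mat_pow M t) \<le> (\<Sum>j\<in>UNIV. K (axis j 1)) * r ^ t" for t
    unfolding sum_distrib_right by (rule order_trans[OF norm_le_sum_columns sum_mono[OF K]])
  then show ?thesis
    by (rule that)
qed

text \<open>On an eigenvector the powers act exactly as \<open>k ^ t\<close>, so a bound of order
  \<open>r ^ t\<close> excludes a modulus above \<open>r\<close>. The eigenvector may be complex
  although \<open>M\<close> is real, hence the comparison of entries.\<close>

lemma spec_radius_le: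
  fixes M :: "real^'n^'n"
  assumes r: "0 < r" and K: "\<And>t. norm (mat_pow M t) \<le> K * r ^ t"
  shows "spec_radius M \<le> r"
proof -
  let ?M = "map_matrix complex_of_real M"
  have "cmod k \<le> r" if k: "k \<in> eigenvals ?M" for k
  proof (rule ccontr)
    assume "\<not> cmod k \<le> r"
    then have gt: "1 < cmod k / r"
      using r by simp
    obtain v where v: "v \<noteq> 0" "?M *v v = k *s v"
      using k by (auto simp: eigenvals_def)
    obtain j where j: "v $ j \<noteq> 0"
      using v(1) by (auto simp: vec_eq_iff)
    have pow: "mat_pow ?M t *v v = k ^ t *s v" for t
      by (induction t)
        (simp_all add: matrix_vector_mul_assoc[symmetric] vec.scale v(2) vec.scale_scale mult.commute)
    \<comment> \<open>Comparing coordinate \<open>j\<close> of \<open>k ^ t *s v\<close> with the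
      growth bound shows that \<open>S\<close> dominates \<open>(cmod k / r) ^ t\<close> for every
      \<open>t\<close>, while these powers are unbounded.\<close>
    define S where "S = (\<Sum>i\<in>UNIV. K * cmod (v $ i)) / cmod (v $ j)"
    obtain t where t: "S < (cmod k / r) ^ t"
      using real_arch_pow[OF gt] by blast
    have "(cmod k / r) ^ t \<le> S"
    proof -
      have "cmod k ^ t * cmod (v $ j) = cmod ((mat_pow ?M t *v v) $ j)"
        by (simp add: pow norm_mult norm_power)
      also have "\<dots> \<le> (\<Sum>i\<in>UNIV. \<bar>mat_pow M t $ j $ i\<bar> * cmod (v $ i))"
        unfolding mat_pow_of_real matrix_vector_mult_def
        by (auto simp: norm_mult intro!: order_trans[OF norm_sum])
      also have "\<dots> \<le> (\<Sum>i\<in>UNIV. K * r ^ t * cmod (v $ i))"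
      proof (intro sum_mono mult_right_mono order_trans[OF _ K])
        show "\<bar>mat_pow M t $ j $ i\<bar> \<le> norm (mat_pow M t)" for i
          using Finite_Cartesian_Product.norm_nth_le[of "mat_pow M t $ j" i]
            Finite_Cartesian_Product.norm_nth_le[of "mat_pow M t" j] by simp
      qed simp
      also have "\<dots> = (\<Sum>i\<in>UNIV. K * cmod (v $ i)) * r ^ t"
        by (simp add: sum_distrib_left sum_distrib_right mult_ac)
      also have "\<dots> = S * r ^ t * cmod (v $ j)"
        unfolding S_def times_divide_eq_left using j by (subst nonzero_eq_divide_eq) simp_all
      finally have "cmod k ^ t \<le> S * r ^ t"
        by (rule mult_right_le_imp_le) (simp only: zero_less_norm_iff j not_False_eq_True)
      then show ?thesis
        by (simp only: power_divide pos_divide_le_eq[OF zero_less_power[OF r]])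
    qed
    with t show False
      by linarith
  qed
  then show ?thesis
    unfolding spec_radius_def using finite_eigenvals eigenvals_nonempty by (intro Max.boundedI) auto
qed

section \<open>Growth of powers, uniformly over a compact parameter set\<close>

lemma norm_mat_pow_le:
  fixes M :: "real^'n^'n"
  shows "norm (mat_pow M t) \<le> norm (mat 1 :: real^'n^'n) * norm M ^ t"
proof (induction t)
  case (Suc t)
  have "norm (mat_pow M (Suc t)) \<le> norm M * norm (mat_pow M t)"
    by (simp add: norm_matrix_mult_le)
  also have "\<dots> \<le> norm M * (norm (mat 1 :: real^'n^'n) * norm M ^ t)"
    using Suc by (rule mult_left_mono) simp
  finally show ?case
    by (simp add: mult_ac)
qed simp

text \<open>Supplies both continuity of powers in the parameter and the exchange of matrix products
  with infinite series.\<close>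

lemma bounded_bilinear_matrix_mult:
  "bounded_bilinear ((**) :: real^'n^'m \<Rightarrow> real^'k^'n \<Rightarrow> real^'k^'m)"
proof
  show "(a + a') ** b = a ** b + a' ** b" for a a' :: "real^'n^'m" and b :: "real^'k^'n"
    by (simp add: vec_eq_iff matrix_matrix_mult_def distrib_right sum.distrib)
  show "a ** (b + b') = a ** b + a ** b'" for a :: "real^'n^'m" and b b' :: "real^'k^'n"
    by (simp add: vec_eq_iff matrix_matrix_mult_def distrib_left sum.distrib)
  show "(c *\<^sub>R a) ** b = c *\<^sub>R (a ** b)" for a :: "real^'n^'m" and b :: "real^'k^'n" and c
    by (simp add: vec_eq_iff matrix_matrix_mult_def sum_distrib_left mult.assoc)
  show "a ** (c *\<^sub>R b) = c *\<^sub>R (a ** b)" for a :: "real^'n^'m" and b :: "real^'k^'n" and c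
    by (simp add: vec_eq_iff matrix_matrix_mult_def sum_distrib_left mult_ac)
  show "\<exists>K. \<forall>(a :: real^'n^'m) (b :: real^'k^'n). norm (a ** b) \<le> norm a * norm b * K"
    by (intro exI[of _ 1]) (simp add: norm_matrix_mult_le)
qed

lemma continuous_on_mat_pow:
  fixes F :: "'a::topological_space \<Rightarrow> real^'n^'n"
  assumes "continuous_on S F"
  shows "continuous_on S (\<lambda>q. mat_pow (F q) t)"
  by (induction t)
    (auto intro: bounded_bilinear.continuous_on[OF bounded_bilinear_matrix_mult assms])

text \<open>Growth at a rate \<open>s\<close> strictly between the spectral radius and
  \<open>r\<close> is eventually beaten by \<open>r ^ k\<close>, whatever the constant.\<close>

lemma mat_pow_contraction:
  fixes M :: "real^'n^'n"
  assumes "spec_radius M < r" "0 < r"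
  obtains k where "0 < k" "norm (mat_pow M k) < r ^ k"
proof -
  define s where "s = max ((spec_radius M + r) / 2) (r / 2)"
  have s: "spec_radius M < s" "0 < s" "s < r"
    using assms by (auto simp: s_def max_def field_simps)
  obtain K where K: "\<And>t. norm (mat_pow M t) \<le> K * s ^ t"
    using mat_pow_growth[OF s(1)] by blast
  \<comment> \<open>The 1 inside the maximum rules out \<open>k = 0\<close>.\<close>
  obtain k where k: "max K 1 < (r / s) ^ k"
    using real_arch_pow[of "r / s" "max K 1"] s by auto
  have "K < r ^ k / s ^ k"
    using k by (simp add: power_divide)
  then have "K * s ^ k < r ^ k"
    using s by (simp add: pos_less_divide_eq)
  then have "norm (mat_pow M k) < r ^ k"
    using K[of k] by linarith
  moreover have "0 < k"
    using k by (intro gr0I) auto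
  ultimately show ?thesis
    by (rule that[rotated])
qed

text \<open>Division of \<open>t\<close> by \<open>k\<close>: each full block of \<open>k\<close>
  steps costs at most \<open>r ^ k\<close>, and the remaining fewer than \<open>k\<close> steps cost
  at most a factor \<open>(R / r) ^ k\<close> over the rate \<open>r\<close>. The Frobenius norm of
  the identity enters once for the blocks and once for the remainder.\<close>

lemma mat_pow_growth_of_contraction:
  fixes M :: "real^'n^'n"
  assumes k: "0 < k" "norm (mat_pow M k) \<le> r ^ k" and r: "0 < r" "r \<le> R" "norm M \<le> R"
  shows "norm (mat_pow M t) \<le> (norm (mat 1 :: real^'n^'n))\<^sup>2 * (R / r) ^ k * r ^ t"
proof -
  define c where "c = norm (mat 1 :: real^'n^'n)"
  have c: "0 \<le> c"
    by (simp add: c_def)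
  define a b where "a = t div k" and "b = t mod k"
  have t: "t = k * a + b" and b: "b \<le> k"
    using k by (auto simp: a_def b_def less_imp_le)
  have "norm (mat_pow M t) \<le> norm (mat_pow (mat_pow M k) a) * norm (mat_pow M b)"
    unfolding t mat_pow_add mat_pow_mult by (rule norm_matrix_mult_le)
  also have "\<dots> \<le> (c * (r ^ k) ^ a) * (c * R ^ b)"
  proof (rule mult_mono)
    have "c * norm (mat_pow M k) ^ a \<le> c * (r ^ k) ^ a"
      using c k by (intro mult_left_mono power_mono) auto
    then show "norm (mat_pow (mat_pow M k) a) \<le> c * (r ^ k) ^ a"
      using norm_mat_pow_le[of "mat_pow M k" a] by (simp add: c_def)
    have "c * norm M ^ b \<le> c * R ^ b"
      using c r by (intro mult_left_mono power_mono) auto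
    then show "norm (mat_pow M b) \<le> c * R ^ b"
      using norm_mat_pow_le[of M b] by (simp add: c_def)
  qed (use c r in auto)
  also have "\<dots> = c\<^sup>2 * (R / r) ^ b * r ^ t"
    using r by (simp add: t power_add power_mult power_divide power2_eq_square)
  also have "\<dots> \<le> c\<^sup>2 * (R / r) ^ k * r ^ t"
    using r b by (intro mult_right_mono mult_left_mono power_increasing) auto
  finally show ?thesis
    by (simp add: c_def)
qed

text \<open>A power that contracts at \<open>q\<close> still contracts on a neighbourhood of
  \<open>q\<close>. Finitely many neighbourhoods cover \<open>S\<close>, so only finitely many
  exponents, and hence constants, occur.\<close>

lemma mat_pow_uniform_growth:
  fixes F :: "'a::topological_space \<Rightarrow> real^'n^'n"
  assumes S: "compact S" and F: "continuous_on S F" and r: "0 < r"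
    and rho: "\<And>q. q \<in> S \<Longrightarrow> spec_radius (F q) < r"
  obtains K where "\<And>q t. q \<in> S \<Longrightarrow> norm (mat_pow (F q) t) \<le> K * r ^ t"
proof -
  obtain R where R: "r \<le> R" "\<And>q. q \<in> S \<Longrightarrow> norm (F q) \<le> R"
  proof -
    obtain R where "\<And>q. q \<in> S \<Longrightarrow> norm (F q) \<le> R"
      using compact_imp_bounded[OF compact_continuous_image[OF F S]] by (auto simp: bounded_iff)
    then show ?thesis
      using that[of "max r R"] by fastforce
  qed
  have "\<exists>k U. 0 < k \<and> open U \<and> q \<in> U \<and> (\<forall>x\<in>U \<inter> S. norm (mat_pow (F x) k) < r ^ k)"
    if q: "q \<in> S" for q
  proof -
    obtain k where k: "0 < k" "norm (mat_pow (F q) k) < r ^ k"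
      using mat_pow_contraction[OF rho[OF q] r] by blast
    have "continuous_on S (\<lambda>q. norm (mat_pow (F q) k))"
      by (intro continuous_on_norm continuous_on_mat_pow F)
    then obtain U where "open U" "U \<inter> S = (\<lambda>q. norm (mat_pow (F q) k)) -` {..<r ^ k} \<inter> S"
      using continuous_on_open_invariant[THEN iffD1, rule_format, of S _ "{..<r ^ k}"] by auto
    then show ?thesis
      using k q by (intro exI[of _ k] exI[of _ U]) auto
  qed
  then obtain k U where kU: "\<And>q. q \<in> S \<Longrightarrow> 0 < k q \<and> open (U q) \<and> q \<in> U q \<and>
      (\<forall>x\<in>U q \<inter> S. norm (mat_pow (F x) (k q)) < r ^ k q)"
    by metis
  obtain D where D: "D \<subseteq> S" "finite D" "S \<subseteq> (\<Union>q\<in>D. U q)"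
    by (rule compactE_image[OF S, of S U]) (use kU in auto)
  \<comment> \<open>The sum of the finitely many nonnegative constants serves as an upper bound for
    each of them.\<close>
  define K where "K = (\<Sum>q\<in>D. (norm (mat 1 :: real^'n^'n))\<^sup>2 * (R / r) ^ k q)"
  have "norm (mat_pow (F q) t) \<le> K * r ^ t" if q: "q \<in> S" for q t
  proof -
    obtain p where p: "p \<in> D" "q \<in> U p"
      using D q by auto
    then have "0 < k p" "norm (mat_pow (F q) (k p)) \<le> r ^ k p"
      using kU[of p] D(1) q by (auto intro: less_imp_le)
    then have "norm (mat_pow (F q) t) \<le> (norm (mat 1 :: real^'n^'n))\<^sup>2 * (R / r) ^ k p * r ^ t"
      by (rule mat_pow_growth_of_contraction[OF _ _ r R(1) R(2)[OF q]])
    also have "\<dots> \<le> K * r ^ t"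
      unfolding K_def using p D r R by (intro mult_right_mono member_le_sum) auto
    finally show ?thesis .
  qed
  then show ?thesis
    by (rule that)
qed

section \<open>Orthonormal eigenbases\<close>

text \<open>For small \<open>s\<close> the quadratic side cannot keep up with a positive linear
  term. This is the first-order condition at the maximum of a quadratic form.\<close>

lemma quadratic_dominates_linear:
  fixes a b :: real
  assumes "\<And>s. 0 < s \<Longrightarrow> 2 * s * a \<le> s\<^sup>2 * b" "0 \<le> a"
  shows "a = 0"
proof (rule ccontr)
  assume "a \<noteq> 0"
  then have a: "0 < a"
    using assms(2) by simp
  define s where "s = a / (\<bar>b\<bar> + 1)"
  have s: "0 < s"
    using a by (simp add: s_def)
  have "s * (2 * a) \<le> s * (s * b)"
    using assms(1)[OF s] by (simp add: power2_eq_square mult_ac)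
  then have "2 * a \<le> s * b"
    using s by (rule mult_left_le_imp_le)
  also have "\<dots> \<le> s * (\<bar>b\<bar> + 1)"
    using s by (intro mult_left_mono) auto
  also have "\<dots> = a"
    by (simp add: s_def)
  finally show False
    using a by simp
qed

text \<open>The form \<open>x \<bullet> f x\<close> attains its maximum \<open>k\<close> on the unit
  sphere of \<open>W\<close>. The residual \<open>h\<close> of the eigenvalue equation at a
  maximizer \<open>u\<close> stays in \<open>W\<close> and is orthogonal to \<open>u\<close>; if it
  were nonzero, moving from \<open>u\<close> in direction \<open>h\<close> would raise the quotient
  to first order.\<close>

lemma symmetric_eigenvector:
  fixes f :: "'a::euclidean_space \<Rightarrow> 'a"
  assumes f: "linear f" and sym: "\<And>x y. f x \<bullet> y = x \<bullet> f y"
    and W: "subspace W" "\<And>x. x \<in> W \<Longrightarrow> f x \<in> W" "W \<noteq> {0}"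
  obtains u where "u \<in> W" "norm u = 1" "f u = (u \<bullet> f u) *\<^sub>R u"
proof -
  interpret linear f by (rule f)
  obtain w where w: "w \<in> W" "w \<noteq> 0"
    using W subspace_0 by blast
  have "compact (sphere 0 1 \<inter> W)"
    by (intro compact_Int_closed compact_sphere closed_subspace W)
  moreover have "(1 / norm w) *\<^sub>R w \<in> sphere 0 1 \<inter> W"
    using w W by (auto simp: subspace_scale)
  then have "sphere 0 1 \<inter> W \<noteq> {}"
    by blast
  moreover have "continuous_on (sphere 0 1 \<inter> W) (\<lambda>x. x \<bullet> f x)"
    by (intro continuous_intros linear_continuous_on_compose[OF _ f])
  ultimately obtain u where "u \<in> sphere 0 1 \<inter> W" "\<forall>x\<in>sphere 0 1 \<inter> W. x \<bullet> f x \<le> u \<bullet> f u"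
    using continuous_attains_sup[of "sphere 0 1 \<inter> W" "\<lambda>x. x \<bullet> f x"] by metis
  then have u: "u \<in> W" "norm u = 1" "\<And>x. x \<in> W \<Longrightarrow> norm x = 1 \<Longrightarrow> x \<bullet> f x \<le> u \<bullet> f u"
    by auto
  define k where "k = u \<bullet> f u"
  have le: "x \<bullet> f x \<le> k * (x \<bullet> x)" if "x \<in> W" for x
  proof (cases "x = 0")
    case False
    define y where "y = (1 / norm x) *\<^sub>R x"
    have "y \<bullet> f y \<le> k"
      unfolding k_def using that False W by (intro u) (auto simp: y_def subspace_scale)
    moreover have "y \<bullet> f y = (x \<bullet> f x) / (norm x)\<^sup>2"
      by (simp add: y_def scale power2_eq_square)
    ultimately show ?thesis
      using False by (simp add: pos_divide_le_eq power2_norm_eq_inner)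
  qed (simp add: zero)
  define h where "h = f u - k *\<^sub>R u"
  have hW: "h \<in> W"
    using u W by (auto simp: h_def subspace_diff subspace_scale)
  have uu: "u \<bullet> u = 1"
    using u by (simp add: norm_eq_1)
  have uh: "u \<bullet> h = 0"
    by (simp add: h_def inner_diff_right k_def uu)
  have "h \<bullet> f u = h \<bullet> h"
    using uh by (simp add: h_def inner_diff_right inner_diff_left inner_commute)
  then have "h \<bullet> f u = h \<bullet> h" "u \<bullet> f h = h \<bullet> h"
    using sym[of u h] by (simp_all add: inner_commute)
  \<comment> \<open>This is \<open>le\<close> at \<open>u + s *\<^sub>R h\<close>: the constant
    terms cancel, and symmetry makes both mixed terms equal to
    \<open>s * (h \<bullet> h)\<close>.\<close>
  then have "2 * s * (h \<bullet> h) \<le> s\<^sup>2 * (k * (h \<bullet> h) - h \<bullet> f h)" for s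
    using le[of "u + s *\<^sub>R h"] u hW W uu uh
    by (simp add: subspace_add subspace_scale add scale inner_add_left inner_add_right
        inner_commute[of h u] k_def[symmetric] algebra_simps power2_eq_square)
  then have "h \<bullet> h = 0"
    by (intro quadratic_dominates_linear) auto
  then have "f u = k *\<^sub>R u"
    by (simp add: h_def)
  then show ?thesis
    using that[OF u(1,2)] by (simp add: k_def)
qed

text \<open>An orthonormal set of eigenvectors of largest cardinality must span: otherwise its
  orthogonal complement is nonzero and, by symmetry, invariant, and so contains a further
  eigenvector.\<close>

lemma symmetric_eigenbasis:
  fixes f :: "'a::euclidean_space \<Rightarrow> 'a"
  assumes f: "linear f" and sym: "\<And>x y. f x \<bullet> y = x \<bullet> f y"
  obtains S where "finite S" "pairwise orthogonal S" "\<And>u. u \<in> S \<Longrightarrow> norm u = 1" "span S = UNIV"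
    "\<And>u. u \<in> S \<Longrightarrow> f u = (u \<bullet> f u) *\<^sub>R u"
proof -
  define ok where "ok S \<longleftrightarrow> pairwise orthogonal S \<and> (\<forall>u\<in>S. norm u = 1) \<and> (\<forall>u\<in>S. f u = (u \<bullet> f u) *\<^sub>R u)"
    for S
  have bound: "finite S \<and> card S \<le> DIM('a)" if "ok S" for S
    using that pairwise_orthogonal_independent[of S] by (intro independent_bound) (force simp: ok_def)
  have "ok {}"
    by (simp add: ok_def)
  then obtain S where S: "ok S" and max: "\<And>T. ok T \<Longrightarrow> card T \<le> card S"
    using ex_has_greatest_nat[of ok "{}" card "Suc DIM('a)"] bound by (metis le_imp_less_Suc)
  have "span S = UNIV"
  proof (rule ccontr)
    assume "span S \<noteq> UNIV"
    then obtain a where a: "a \<noteq> 0" "\<forall>x\<in>span S. a \<bullet> x = 0"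
      using span_not_UNIV_orthogonal by blast
    define W where "W = {y. \<forall>x\<in>S. orthogonal x y}"
    have "a \<in> W"
      using a by (auto simp: W_def orthogonal_def inner_commute span_base)
    then have "W \<noteq> {0}"
      using a by auto
    moreover have "subspace W"
      unfolding W_def by (rule subspace_orthogonal_to_vectors)
    moreover have "f y \<in> W" if "y \<in> W" for y
    proof -
      have "x \<bullet> f y = 0" if "x \<in> S" for x
      proof -
        have "x \<bullet> f y = f x \<bullet> y"
          by (simp add: sym)
        also have "\<dots> = (x \<bullet> f x) * (x \<bullet> y)"
          using S that by (metis ok_def inner_scaleR_left)
        finally show ?thesis
          using \<open>y \<in> W\<close> that by (simp add: W_def orthogonal_def)
      qed
      then show ?thesis
        by (simp add: W_def orthogonal_def)
    qed
    ultimately obtain u where u: "u \<in> W" "norm u = 1" "f u = (u \<bullet> f u) *\<^sub>R u"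
      using symmetric_eigenvector[OF f sym] by metis
    have "u \<notin> S"
      using u by (auto simp: W_def orthogonal_self)
    have "ok (insert u S)"
      using S u by (auto simp: ok_def W_def pairwise_insert orthogonal_commute)
    then have "card (insert u S) \<le> card S"
      by (rule max)
    then show False
      using bound[OF S] \<open>u \<notin> S\<close> by simp
  qed
  then show ?thesis
    using that[of S] S bound[OF S] by (auto simp: ok_def)
qed

lemma sum_inner_orthonormal_sq:
  fixes S :: "'a::euclidean_space set"
  assumes "finite S" "pairwise orthogonal S" "\<And>u. u \<in> S \<Longrightarrow> norm u = 1" "span S = UNIV"
  shows "(\<Sum>u\<in>S. (x \<bullet> u)\<^sup>2) = (norm x)\<^sup>2"
proof -
  have "(norm x)\<^sup>2 = x \<bullet> (\<Sum>u\<in>S. (x \<bullet> u) *\<^sub>R u)"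
    using orthonormal_basis_expand[of S x] assms by (simp add: power2_norm_eq_inner)
  then show ?thesis
    by (simp add: inner_sum_right power2_eq_square)
qed

text \<open>Parseval applied to each row. It allows the matrix-valued error to be studied through
  its images of the eigenvectors of \<open>Q\<close>, one vector recursion at a time.\<close>

lemma norm_sq_eq_sum_orthonormal:
  fixes S :: "(real^'d) set" and X :: "real^'d^'n"
  assumes "finite S" "pairwise orthogonal S" "\<And>u. u \<in> S \<Longrightarrow> norm u = 1" "span S = UNIV"
  shows "(norm X)\<^sup>2 = (\<Sum>u\<in>S. (norm (X *v u))\<^sup>2)"
proof -
  have "(norm X)\<^sup>2 = (\<Sum>i\<in>UNIV. (norm (X $ i))\<^sup>2)"
    by (simp add: norm_vec_def[of X] L2_set_def sum_nonneg)
  also have "\<dots> = (\<Sum>i\<in>UNIV. \<Sum>u\<in>S. (X $ i \<bullet> u)\<^sup>2)"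
    by (simp add: sum_inner_orthonormal_sq[OF assms])
  also have "\<dots> = (\<Sum>u\<in>S. \<Sum>i\<in>UNIV. (X $ i \<bullet> u)\<^sup>2)"
    by (rule sum.swap)
  also have "\<dots> = (\<Sum>u\<in>S. (norm (X *v u))\<^sup>2)"
    by (simp add: norm_vec_def[of "X *v _"] L2_set_def sum_nonneg matrix_vector_mul_component)
  finally show ?thesis .
qed

section \<open>The quadratic function class\<close>

definition quad_fun :: "real^'d^'d \<Rightarrow> real^'d^1 \<Rightarrow> real \<Rightarrow> real^'d^1 \<Rightarrow> real" where
  "quad_fun Q ystar fstar y = 1/2 * ((y - ystar) ** Q ** transpose (y - ystar)) $ 1 $ 1 + fstar"

lemma quad_class_altdef:
  "quad_class m L = {quad_fun Q ystar fstar |Q ystar fstar. transpose Q = Q \<and> eigenvals Q \<subseteq> {m..L}}"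
  by (auto simp: quad_class_def quad_fun_def fun_eq_iff)

lemma symmetric_inner:
  fixes Q :: "real^'d^'d"
  assumes "transpose Q = Q"
  shows "(Q *v x) \<bullet> y = x \<bullet> (Q *v y)"
proof -
  have "x v* Q = Q *v x"
    by (metis assms transpose_matrix_vector)
  then show ?thesis
    using dot_lmul_matrix[of x Q y] by simp
qed

lemma row_matrix_mult: "(x ** Q) $ i = transpose Q *v (x $ i)"
  for x :: "real^'n^'m" and Q :: "real^'k^'n"
  by (simp add: vec_eq_iff matrix_matrix_mult_def matrix_vector_mult_def transpose_def mult.commute)

lemma quad_fun_inner:
  fixes Q :: "real^'d^'d"
  shows "quad_fun Q ystar fstar y = 1/2 * ((y - ystar) $ 1 \<bullet> (Q *v ((y - ystar) $ 1))) + fstar"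
proof -
  have "(x ** Q ** transpose x) $ 1 $ 1 = x $ 1 \<bullet> (Q *v (x $ 1))" for x :: "real^'d^1"
    unfolding matrix_mul_assoc[symmetric]
    by (simp add: matrix_matrix_mult_def matrix_vector_mult_def transpose_def inner_vec_def)
  then show ?thesis
    by (simp add: quad_fun_def)
qed

lemma gradient_eqI:
  assumes "GDERIV f x :> g"
  shows "gradient f x = g"
  unfolding gradient_def
proof (rule the_equality)
  fix h
  assume "GDERIV f x :> h"
  then have "(\<lambda>y. y \<bullet> h) = (\<lambda>y. y \<bullet> g)"
    using assms unfolding gderiv_def by (rule has_derivative_unique)
  then show "h = g"
    by (simp add: fun_eq_iff vector_eq_ldot)
qed (rule assms)

lemma inner_row: "(x :: real^'d^1) \<bullet> y = x $ 1 \<bullet> y $ 1"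
  by (simp add: inner_vec_def[of x])

text \<open>The product rule yields two mixed terms; symmetry of \<open>Q\<close> identifies them
  and cancels the factor 1/2.\<close>

lemma gradient_quad_fun:
  fixes Q :: "real^'d^'d"
  assumes "transpose Q = Q"
  shows "gradient (quad_fun Q ystar fstar) y = (y - ystar) ** Q"
proof (rule gradient_eqI)
  have lin: "((\<lambda>y. (y - ystar) $ 1) has_derivative (\<lambda>h. h $ 1)) (at y)"
    by (rule bounded_linear.has_derivative[OF bounded_linear_vec_nth])
      (auto intro!: derivative_eq_intros)
  have "((\<lambda>y. 1/2 * ((y - ystar) $ 1 \<bullet> (Q *v ((y - ystar) $ 1))) + fstar) has_derivative
      (\<lambda>h. 1/2 * ((y - ystar) $ 1 \<bullet> (Q *v (h $ 1)) + h $ 1 \<bullet> (Q *v ((y - ystar) $ 1))))) (at y)"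
    by (rule derivative_eq_intros lin bounded_linear.has_derivative[OF matrix_vector_mul_bounded_linear] refl)+ simp
  moreover have "1/2 * ((y - ystar) $ 1 \<bullet> (Q *v (h $ 1)) + h $ 1 \<bullet> (Q *v ((y - ystar) $ 1)))
      = h \<bullet> ((y - ystar) ** Q)" for h :: "real^'d^1"
    by (simp add: inner_row row_matrix_mult assms symmetric_inner[OF assms, symmetric] inner_commute del: transpose_matrix_vector)
  ultimately show "GDERIV (quad_fun Q ystar fstar) y :> (y - ystar) ** Q"
    by (simp add: gderiv_def quad_fun_inner[abs_def])
qed

lemma symmetric_matrix_eigenbasis:
  fixes Q :: "real^'d^'d"
  assumes Q: "transpose Q = Q"
  obtains S k where "finite S" "pairwise orthogonal S" "\<And>u. u \<in> S \<Longrightarrow> norm u = 1" "span S = UNIV"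
    "\<And>u. u \<in> S \<Longrightarrow> Q *v u = k u *s u" "\<And>u. u \<in> S \<Longrightarrow> k u \<in> eigenvals Q"
proof -
  obtain S where S: "finite S" "pairwise orthogonal S" "\<And>u. u \<in> S \<Longrightarrow> norm u = 1" "span S = UNIV"
    "\<And>u. u \<in> S \<Longrightarrow> Q *v u = (u \<bullet> (Q *v u)) *\<^sub>R u"
    using symmetric_eigenbasis[of "(*v) Q"] symmetric_inner[OF Q] by blast
  define k where "k u = u \<bullet> (Q *v u)" for u
  have "Q *v u = k u *s u" if "u \<in> S" for u
    using S(5)[OF that] by (simp add: k_def scalar_mult_eq_scaleR)
  moreover have "k u \<in> eigenvals Q" if "u \<in> S" for u
  proof -
    have "u \<noteq> 0"
      using S(3)[OF that] by auto
    then show ?thesis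
      using \<open>u \<in> S \<Longrightarrow> Q *v u = k u *s u\<close> that by (auto simp: eigenvals_def)
  qed
  ultimately show ?thesis
    using that S(1-4) by blast
qed

text \<open>Positive eigenvalues make the quadratic form positive definite, so the minimizer is
  unique and the choice inside \<open>arg_min\<close> is forced.\<close>

lemma opt_quad_fun:
  fixes Q :: "real^'d^'d"
  assumes Q: "transpose Q = Q" and eig: "eigenvals Q \<subseteq> {m..L}" and m: "0 < m"
  shows "opt (quad_fun Q ystar fstar) = ystar"
proof -
  obtain S k where S: "finite S" "pairwise orthogonal S" "\<And>u. u \<in> S \<Longrightarrow> norm u = 1" "span S = UNIV"
    and k: "\<And>u. u \<in> S \<Longrightarrow> Q *v u = k u *s u" "\<And>u. u \<in> S \<Longrightarrow> k u \<in> eigenvals Q"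
    using symmetric_matrix_eigenbasis[OF Q] by blast
  have pos: "0 < x \<bullet> (Q *v x)" if "x \<noteq> 0" for x
  proof -
    have "0 < m * (norm x)\<^sup>2"
      using that m by simp
    also have "\<dots> = (\<Sum>u\<in>S. m * (x \<bullet> u)\<^sup>2)"
      by (simp add: sum_inner_orthonormal_sq[OF S, symmetric] sum_distrib_left)
    also have "\<dots> \<le> (\<Sum>u\<in>S. k u * (x \<bullet> u)\<^sup>2)"
      using k(2) eig by (intro sum_mono mult_right_mono) (auto simp: subset_iff)
    also have "\<dots> = (Q *v x) \<bullet> (\<Sum>u\<in>S. (x \<bullet> u) *\<^sub>R u)"
      by (simp add: inner_sum_right symmetric_inner[OF Q] k(1) scalar_mult_eq_scaleR power2_eq_square mult_ac)
    also have "\<dots> = x \<bullet> (Q *v x)"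
      using orthonormal_basis_expand[of S x] S by (simp add: inner_commute)
    finally show ?thesis .
  qed
  have less: "quad_fun Q ystar fstar ystar < quad_fun Q ystar fstar y" if "y \<noteq> ystar" for y
  proof -
    have "(y - ystar) $ 1 \<noteq> 0"
      using that by (simp add: vec_eq_iff)
    then show ?thesis
      using pos by (simp add: quad_fun_inner)
  qed
  have le: "quad_fun Q ystar fstar ystar \<le> quad_fun Q ystar fstar y" for y
    using less[of y] by (cases "y = ystar") auto
  show ?thesis
    unfolding opt_def arg_min_def is_arg_min_def
  proof (rule some_equality)
    show "True \<and> (\<nexists>y. True \<and> quad_fun Q ystar fstar y < quad_fun Q ystar fstar ystar)"
      using le by (simp add: not_less)
  qed (use less in blast)
qed

lemma mat_vector_mult: "mat q *v v = q *s v" for v :: "'a::field^'n"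
  by (simp add: vec_eq_iff matrix_vector_mult_def mat_def if_distrib[of "\<lambda>x. x * _"] cong: if_cong)

lemma eigenvals_mat: "eigenvals (mat q :: 'a::field^'n^'n) \<subseteq> {q}"
  by (auto simp: eigenvals_def mat_vector_mult)

lemma transpose_mat_scalar: "transpose (mat q) = mat q"
  by (auto simp: vec_eq_iff transpose_def mat_def)

lemma quad_fun_mat_in_quad_class: "q \<in> {m..L} \<Longrightarrow> quad_fun (mat q) 0 0 \<in> quad_class m L"
  using eigenvals_mat[of q] by (force simp: quad_class_altdef transpose_mat_scalar)

section \<open>The error recursion\<close>

lemma fixpt:
  assumes "alg_form A C"
  shows "A ** fixpt A C f = fixpt A C f" "C ** fixpt A C f = opt f"
proof -
  obtain v where v: "A *v v = v" "C *v v \<noteq> 0"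
    using assms by (auto simp: alg_form_def)
  then have c: "(C *v v) $ 1 \<noteq> 0"
    by (simp add: vec_eq_iff)
  \<comment> \<open>A rank-one matrix: each column is the eigenvector \<open>v\<close>, rescaled so
    that \<open>C\<close> sends it to the matching coordinate of the minimizer. The scalar
    \<open>C *v v\<close> is nonzero, so the division is legitimate.\<close>
  define x where "x = (\<chi> i j. v $ i * (opt f $ 1 $ j / (C *v v) $ 1))"
  have mult: "N ** x = (\<chi> i j. (N *v v) $ i * (opt f $ 1 $ j / (C *v v) $ 1))" for N :: "real^'a^'m::finite"
    by (simp add: vec_eq_iff x_def matrix_matrix_mult_def matrix_vector_mult_def sum_distrib_right sum_divide_distrib mult.assoc)
  have "x = A ** x \<and> opt f = C ** x"
    using c by (simp add: mult v(1)) (simp add: x_def vec_eq_iff)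
  then have "fixpt A C f = A ** fixpt A C f \<and> opt f = C ** fixpt A C f"
    unfolding fixpt_def by (rule someI)
  then show "A ** fixpt A C f = fixpt A C f" "C ** fixpt A C f = opt f"
    by simp_all
qed

lemma state_error_Suc:
  fixes f :: "real^'d^1 \<Rightarrow> real" and A :: "real^'n^'n" and B :: "real^1^'n" and C :: "real^'n^1"
    and x0 :: "real^'d^'n" and w :: "nat \<Rightarrow> real^'d^1"
  assumes "alg_form A C" and f: "f = quad_fun Q ystar fstar" "opt f = ystar" and Q: "transpose Q = Q"
  defines "e \<equiv> \<lambda>t. state A B C f w x0 t - fixpt A C f"
  shows "e (Suc t) = A ** e t + B ** (C ** e t ** Q + w t)"
proof -
  have "gradient f (C ** state A B C f w x0 t) = C ** e t ** Q"
    by (simp add: f(1) gradient_quad_fun[OF Q] e_def bounded_bilinear.diff_right[OF bounded_bilinear_matrix_mult] fixpt[OF assms(1)] f(2)[unfolded f(1)])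
  then show ?thesis
    by (simp add: e_def bounded_bilinear.diff_right[OF bounded_bilinear_matrix_mult] fixpt[OF assms(1)])
qed

lemma matrix_vector_mult_1: "B *v z = z $ 1 *\<^sub>R column 1 B" for B :: "real^1^'n"
  by (simp add: vec_eq_iff matrix_vector_mult_def column_def mult.commute)

text \<open>Applied to \<open>u\<close>, the right factor \<open>Q\<close> becomes the scalar
  \<open>k\<close>, which closes the loop; the rest is variation of constants. Noise drawn at time
  \<open>s\<close> first enters the state at time \<open>s + 1\<close>, so \<open>t - 1 - s\<close>
  further steps remain, and \<open>s < t\<close> keeps the natural subtraction exact.\<close>

lemma state_error_eigen:
  fixes f :: "real^'d^1 \<Rightarrow> real" and A :: "real^'n^'n" and B :: "real^1^'n" and C :: "real^'n^1"
    and x0 :: "real^'d^'n" and w :: "nat \<Rightarrow> real^'d^1"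
  assumes "alg_form A C" and f: "f = quad_fun Q ystar fstar" "opt f = ystar" and Q: "transpose Q = Q"
    and u: "Q *v u = k *s u"
  defines "e \<equiv> \<lambda>t. state A B C f w x0 t - fixpt A C f" and "M \<equiv> A + k *\<^sub>R (B ** C)"
  shows "e t *v u = mat_pow M t *v (e 0 *v u)
    + (\<Sum>s<t. (w s $ 1 \<bullet> u) *\<^sub>R (mat_pow M (t - 1 - s) *v column 1 B))"
proof (induction t)
  case (Suc t)
  have "e (Suc t) *v u = A *v (e t *v u) + B *v (C *v (e t *v (k *s u))) + B *v (w t *v u)"
    unfolding e_def state_error_Suc[OF assms(1-4)]
    by (simp add: matrix_vector_mult_add_rdistrib matrix_vector_mul_assoc[symmetric] u
        matrix_vector_right_distrib)
  also have "\<dots> = M *v (e t *v u) + (w t $ 1 \<bullet> u) *\<^sub>R column 1 B"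
    by (simp add: M_def matrix_vector_mult_add_rdistrib matrix_vector_mul_assoc[symmetric] vec.scale
        scaleR_matrix_vector_assoc[symmetric] scalar_mult_eq_scaleR matrix_vector_mult_1
        matrix_vector_mul_component matrix_vector_mult_scaleR)
  also have "M *v (e t *v u) = mat_pow M (Suc t) *v (e 0 *v u)
      + (\<Sum>s<t. (w s $ 1 \<bullet> u) *\<^sub>R (mat_pow M (t - s) *v column 1 B))"
  proof -
    have "M *v (c *\<^sub>R (mat_pow M (t - 1 - s) *v b)) = c *\<^sub>R (mat_pow M (t - s) *v b)" if "s < t" for s c b
    proof -
      have "t - s = Suc (t - 1 - s)"
        using that by simp
      then show ?thesis
        by (metis (no_types) mat_pow.simps(2) matrix_vector_mul_assoc matrix_vector_mult_scaleR)
    qed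
    then show ?thesis
      by (simp add: Suc matrix_vector_right_distrib matrix_vector_mult_sum_right matrix_vector_mul_assoc matrix_mul_assoc)
  qed
  finally show ?case
    by simp
qed simp

section \<open>The convergence rate\<close>

abbreviation (input) closed_loop :: "real^'n^'n \<Rightarrow> real^1^'n \<Rightarrow> real^'n^1 \<Rightarrow> real \<Rightarrow> real^'n^'n" where
  "closed_loop A B C q \<equiv> A + q *\<^sub>R (B ** C)"

definition rate_bound :: "real^'n^'n \<Rightarrow> real^1^'n \<Rightarrow> real^'n^1 \<Rightarrow> (real^'d^1 \<Rightarrow> real) set \<Rightarrow> real \<Rightarrow> ereal" where
  "rate_bound A B C F r = (SUP f \<in> F. SUP x0 \<in> - {fixpt A C f}. SUP t.
        ereal (norm (state A B C f (\<lambda>_. 0) x0 t - fixpt A C f)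
               / (r ^ t * norm (x0 - fixpt A C f))))"

lemma rate_altdef: "rate A B C F = (INF r \<in> {r. 0 < r \<and> rate_bound A B C F r < \<infinity>}. ereal r)"
  by (simp add: rate_def rate_bound_def)

text \<open>The constant \<open>c\<close> bounds the powers for every eigenvalue of \<open>Q\<close>
  at once, so squaring and adding over the eigenbasis keeps it unchanged.\<close>

lemma noiseless_error_le:
  fixes A :: "real^'n^'n" and f :: "real^'d^1 \<Rightarrow> real"
  assumes "0 < m" and f: "f \<in> quad_class m L" and alg: "alg_form A C"
    and growth: "\<And>q. q \<in> {m..L} \<Longrightarrow> norm (mat_pow (closed_loop A B C q) t) \<le> c"
  shows "norm (state A B C f (\<lambda>_. 0) x0 t - fixpt A C f) \<le> c * norm (x0 - fixpt A C f)"
proof -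
  obtain Q ystar fstar where f: "f = quad_fun Q ystar fstar" and Q: "transpose Q = Q" "eigenvals Q \<subseteq> {m..L}"
    using f by (auto simp: quad_class_altdef)
  obtain S k where S: "finite S" "pairwise orthogonal S" "\<And>u. u \<in> S \<Longrightarrow> norm u = 1" "span S = UNIV"
    and k: "\<And>u. u \<in> S \<Longrightarrow> Q *v u = k u *s u" "\<And>u. u \<in> S \<Longrightarrow> k u \<in> eigenvals Q"
    using symmetric_matrix_eigenbasis[OF Q(1)] by blast
  have opt: "opt f = ystar"
    unfolding f by (rule opt_quad_fun[OF Q \<open>0 < m\<close>])
  define e where "e t = state A B C f (\<lambda>_. 0) x0 t - fixpt A C f" for t
  have c: "0 \<le> c" if "q \<in> {m..L}" for q
    using growth[OF that] norm_ge_zero order_trans by blast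
  have "norm (e t *v u) \<le> c * norm (e 0 *v u)" if "u \<in> S" for u
  proof -
    have "e t *v u = mat_pow (closed_loop A B C (k u)) t *v (e 0 *v u)"
      unfolding e_def by (subst state_error_eigen[OF alg f opt Q(1) k(1)[OF that]]) simp
    then have "norm (e t *v u) \<le> norm (mat_pow (closed_loop A B C (k u)) t) * norm (e 0 *v u)"
      by (simp add: norm_matrix_vector_mult_le)
    also have "\<dots> \<le> c * norm (e 0 *v u)"
      using k(2)[OF that] Q(2) by (intro mult_right_mono growth) auto
    finally show ?thesis .
  qed
  then have "(\<Sum>u\<in>S. (norm (e t *v u))\<^sup>2) \<le> (\<Sum>u\<in>S. (c * norm (e 0 *v u))\<^sup>2)"
    by (intro sum_mono power_mono) auto
  then have "(norm (e t))\<^sup>2 \<le> (c * norm (e 0))\<^sup>2"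
    by (simp add: norm_sq_eq_sum_orthonormal[OF S] power_mult_distrib sum_distrib_left)
  \<comment> \<open>Nonnegativity is read off from the growth bound at some point of the interval;
    an eigenvalue of \<open>Q\<close> provides one, the eigenbasis being nonempty.\<close>
  moreover have "0 \<le> c"
  proof -
    have "(1 :: real^'d) \<in> span S"
      by (simp add: S(4))
    then have "S \<noteq> {}"
      by auto
    then obtain u where "u \<in> S"
      by blast
    then show ?thesis
      using k(2) Q(2) c by blast
  qed
  ultimately show ?thesis
    by (simp add: e_def power2_le_iff_abs_le)
qed

lemma rate_bound_le:
  assumes "0 < m" "alg_form A C" "0 < r"
    and growth: "\<And>q t. q \<in> {m..L} \<Longrightarrow> norm (mat_pow (closed_loop A B C q) t) \<le> K * r ^ t"
  shows "rate_bound A B C (quad_class m L :: (real^'d^1 \<Rightarrow> real) set) r \<le> ereal K"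
  unfolding rate_bound_def
proof (intro SUP_least)
  fix f :: "real^'d^1 \<Rightarrow> real" and x0 t
  assume "f \<in> quad_class m L" "x0 \<in> - {fixpt A C f}"
  then show "ereal (norm (state A B C f (\<lambda>_. 0) x0 t - fixpt A C f) / (r ^ t * norm (x0 - fixpt A C f))) \<le> ereal K"
    using noiseless_error_le[OF assms(1) _ assms(2) growth, where f = f and ?x0.0 = x0] assms(3)
    by (simp add: pos_divide_le_eq mult.assoc)
qed

text \<open>With Hessian \<open>q I\<close> every unit vector is an eigenvector, so any vector
  \<open>v\<close> can be placed in a single column of the initial error, where it evolves under the
  powers of the closed loop.\<close>

lemma growth_of_rate_bound:
  fixes A :: "real^'n^'n"
  assumes "0 < m" "alg_form A C" "0 < r"
    and bound: "rate_bound A B C (quad_class m L :: (real^'d^1 \<Rightarrow> real) set) r < \<infinity>"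
  obtains K where "\<And>q t. q \<in> {m..L} \<Longrightarrow> norm (mat_pow (closed_loop A B C q) t) \<le> K * r ^ t"
proof -
  obtain K where K: "rate_bound A B C (quad_class m L :: (real^'d^1 \<Rightarrow> real) set) r \<le> ereal K"
    using bound by (cases "rate_bound A B C (quad_class m L :: (real^'d^1 \<Rightarrow> real) set) r") auto
  have "norm (mat_pow (closed_loop A B C q) t *v v) \<le> K * r ^ t * norm v" if q: "q \<in> {m..L}" for q t v
  proof (cases "v = 0")
    case False
    define f :: "real^'d^1 \<Rightarrow> real" where "f = quad_fun (mat q) 0 0"
    have f: "f \<in> quad_class m L"
      unfolding f_def by (rule quad_fun_mat_in_quad_class[OF q])
    define j :: 'd where "j = undefined"
    \<comment> \<open>Column \<open>j\<close> is \<open>v\<close> and all other columns vanish, so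
      the norm is that of \<open>v\<close>; the index \<open>j\<close> is arbitrary.\<close>
    define e0 :: "real^'d^'n" where "e0 = (\<chi> i. axis j (v $ i))"
    have "norm e0 = norm v"
      by (simp add: norm_vec_def[of v] norm_vec_def[of e0]) (simp add: e0_def norm_axis_eq)
    moreover have "e0 *v axis j 1 = v"
      by (simp add: e0_def matrix_vector_mult_basis column_def axis_nth vec_eq_iff)
    ultimately have e0: "norm e0 = norm v" "e0 *v axis j 1 = v" .
    define e where "e t = state A B C f (\<lambda>_. 0) (fixpt A C f + e0) t - fixpt A C f" for t
    have "e t *v axis j 1 = mat_pow (closed_loop A B C q) t *v v"
      unfolding e_def
      using opt_quad_fun[OF transpose_mat_scalar order_trans[OF eigenvals_mat, of q "{m..L}"] assms(1)] q
      by (subst state_error_eigen[OF assms(2) f_def _ transpose_mat_scalar mat_vector_mult]) (auto simp: f_def e0)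
    then have "norm (mat_pow (closed_loop A B C q) t *v v) \<le> norm (e t)"
      using norm_matrix_vector_mult_le[of "e t" "axis j 1"] by (simp add: norm_axis_eq)
    also have "\<dots> \<le> K * r ^ t * norm v"
    proof -
      have x0: "fixpt A C f + e0 \<in> - {fixpt A C f}"
        using False e0 by auto
      have "ereal (norm (e t) / (r ^ t * norm e0)) \<le> rate_bound A B C (quad_class m L :: (real^'d^1 \<Rightarrow> real) set) r"
        unfolding rate_bound_def e_def
        by (rule SUP_upper2[OF f], rule SUP_upper2[OF x0], rule SUP_upper2[of t]) simp_all
      then have "norm (e t) / (r ^ t * norm e0) \<le> K"
        using K order_trans by fastforce
      then show ?thesis
        using False assms(3) e0 by (simp add: pos_divide_le_eq mult.assoc)
    qed
    finally show ?thesis .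
  qed simp
  then have col: "norm (mat_pow (closed_loop A B C q) t *v axis j 1) \<le> K * r ^ t" if "q \<in> {m..L}" for q t j
    using that by (metis mult.right_neutral norm_axis_1)
  then have "norm (mat_pow (closed_loop A B C q) t) \<le> (real CARD('n) * K) * r ^ t" if q: "q \<in> {m..L}" for q t
  proof -
    have "(\<Sum>j\<in>UNIV. norm (mat_pow (closed_loop A B C q) t *v axis j 1)) \<le> (\<Sum>j\<in>(UNIV :: 'n set). K * r ^ t)"
      by (intro sum_mono col q)
    then show ?thesis
      using norm_le_sum_columns[of "mat_pow (closed_loop A B C q) t"] by simp
  qed
  then show ?thesis
    by (rule that)
qed

lemma rate_quad_class:
  fixes A :: "real^'n^'n"
  assumes m: "0 < m" "m \<le> L" and alg: "alg_form A C"
  shows "rate A B C (quad_class m L :: (real^'d^1 \<Rightarrow> real) set)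
    = (SUP q \<in> {m..L}. ereal (spec_radius (closed_loop A B C q)))" (is "?rate = ?rho")
proof (rule antisym)
  show "?rho \<le> ?rate"
    unfolding rate_altdef
  proof (intro SUP_least INF_greatest)
    fix q r assume q: "q \<in> {m..L}"
      and r: "r \<in> {r. 0 < r \<and> rate_bound A B C (quad_class m L :: (real^'d^1 \<Rightarrow> real) set) r < \<infinity>}"
    then have "0 < r" "rate_bound A B C (quad_class m L :: (real^'d^1 \<Rightarrow> real) set) r < \<infinity>"
      by simp_all
    then obtain K where K: "\<And>q t. q \<in> {m..L} \<Longrightarrow> norm (mat_pow (closed_loop A B C q) t) \<le> K * r ^ t"
      by (rule growth_of_rate_bound[OF m(1) alg]) (rule that, blast)
    have "spec_radius (closed_loop A B C q) \<le> r"
      by (rule spec_radius_le[OF _ K[OF q]]) (use r in simp)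
    then show "ereal (spec_radius (closed_loop A B C q)) \<le> ereal r"
      by simp
  qed
  show "?rate \<le> ?rho"
  proof (rule ccontr)
    \<comment> \<open>An \<open>r\<close> strictly inside the gap exceeds each spectral radius,
      hence is admissible by the uniform growth bound, and yet lies below the infimum of admissible
      values.\<close>
    assume "\<not> ?rate \<le> ?rho"
    then obtain r where r: "?rho < ereal r" "ereal r < ?rate"
      using ereal_dense2[of ?rho ?rate] by (auto simp: not_le)
    have rho: "spec_radius (closed_loop A B C q) < r" if "q \<in> {m..L}" for q
      using order_le_less_trans[OF SUP_upper[OF that, of "\<lambda>q. ereal (spec_radius (closed_loop A B C q))"] r(1)]
      by simp
    have "0 \<le> spec_radius (closed_loop A B C m)"
      unfolding spec_radius_def using finite_eigenvals eigenvals_nonempty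
      by (subst Max_ge_iff) (auto simp: ex_in_conv)
    then have r0: "0 < r"
      using rho[of m] m by auto
    have "continuous_on {m..L} (closed_loop A B C)"
      by (intro continuous_intros)
    then obtain K where K: "\<And>q t. q \<in> {m..L} \<Longrightarrow> norm (mat_pow (closed_loop A B C q) t) \<le> K * r ^ t"
      by (rule mat_pow_uniform_growth[OF compact_Icc _ r0 rho]) (assumption, rule that, blast)
    have "rate_bound A B C (quad_class m L :: (real^'d^1 \<Rightarrow> real) set) r \<le> ereal K"
      by (rule rate_bound_le[OF m(1) alg r0 K])
    then have "rate_bound A B C (quad_class m L :: (real^'d^1 \<Rightarrow> real) set) r < \<infinity>"
      by (rule order_le_less_trans) simp
    then have "?rate \<le> ereal r"
      unfolding rate_altdef using r0 by (intro INF_lower) auto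
    then show False
      using r(2) by simp
  qed
qed

lemma growth_of_rate_less_1:
  fixes A :: "real^'n^'n"
  assumes "0 < m" "alg_form A C" "rate A B C (quad_class m L :: (real^'d^1 \<Rightarrow> real) set) < 1"
  shows "\<exists>r K. 0 < r \<and> r < 1 \<and> (\<forall>q\<in>{m..L}. \<forall>t. norm (mat_pow (closed_loop A B C q) t) \<le> K * r ^ t)"
proof -
  obtain r where r: "0 < r" "rate_bound A B C (quad_class m L :: (real^'d^1 \<Rightarrow> real) set) r < \<infinity>" "r < 1"
    using assms(3) by (auto simp: rate_altdef INF_less_iff one_ereal_def)
  obtain K where K: "\<And>q t. q \<in> {m..L} \<Longrightarrow> norm (mat_pow (closed_loop A B C q) t) \<le> K * r ^ t"
    using growth_of_rate_bound[OF assms(1,2) r(1,2)] by blast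
  show ?thesis
    using r K by (intro exI[of _ r] exI[of _ K]) auto
qed

section \<open>The Lyapunov equation\<close>

text \<open>Impulse response from the noise to the output; index \<open>k\<close> corresponds to a
  delay of \<open>k + 1\<close> steps.\<close>

definition gain :: "real^'n^'n \<Rightarrow> real^1^'n \<Rightarrow> real^'n^1 \<Rightarrow> real \<Rightarrow> nat \<Rightarrow> real" where
  "gain A B C q k = (C *v (mat_pow (closed_loop A B C q) k *v column 1 B)) $ 1"

context
  fixes M :: "real^'n^'n" and K r :: real
  assumes r: "0 < r" "r < 1" and growth: "\<And>t. norm (mat_pow M t) \<le> K * r ^ t"
begin

lemma growth_const_nonneg: "0 \<le> K"
  using order_trans[OF norm_ge_zero growth[of 0]] by simp

lemma norm_congruence_le:
  "norm (transpose (mat_pow M t) ** X ** mat_pow M t) \<le> K\<^sup>2 * norm X * (r\<^sup>2) ^ t"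
proof -
  have "norm (transpose (mat_pow M t) ** X ** mat_pow M t)
      \<le> norm (transpose (mat_pow M t) ** X) * norm (mat_pow M t)"
    by (rule norm_matrix_mult_le)
  also have "\<dots> \<le> (norm (transpose (mat_pow M t)) * norm X) * norm (mat_pow M t)"
    by (intro mult_right_mono norm_matrix_mult_le) simp
  also have "\<dots> \<le> (K * r ^ t * norm X) * (K * r ^ t)"
    using growth_const_nonneg r by (intro mult_mono growth) (auto simp: norm_transpose growth intro: mult_nonneg_nonneg)
  also have "\<dots> = K\<^sup>2 * norm X * (r\<^sup>2) ^ t"
    by (simp add: power2_eq_square power_mult_distrib)
  finally show ?thesis .
qed

lemma summable_congruence: "summable (\<lambda>t. transpose (mat_pow M t) ** X ** mat_pow M t)"
proof (rule summable_comparison_test')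
  show "summable (\<lambda>t. K\<^sup>2 * norm X * (r\<^sup>2) ^ t)"
    using r by (intro summable_mult summable_geometric) (simp add: power_less_one_iff)
qed (rule norm_congruence_le)

lemma bounded_linear_congruence:
  fixes L :: "real^'n^'m" and R :: "real^'k^'n"
  shows "bounded_linear (\<lambda>X. L ** X ** R)"
  using bounded_linear_compose[OF bounded_bilinear.bounded_linear_left[OF bounded_bilinear_matrix_mult]
      bounded_bilinear.bounded_linear_right[OF bounded_bilinear_matrix_mult]] .

text \<open>Congruence with \<open>M\<close> shifts the series by one index, which removes exactly
  its first term \<open>X\<close>.\<close>

lemma lyapunov_series:
  "transpose M ** (\<Sum>t. transpose (mat_pow M t) ** X ** mat_pow M t) ** M
    - (\<Sum>t. transpose (mat_pow M t) ** X ** mat_pow M t) + X = 0"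
proof -
  let ?f = "\<lambda>t. transpose (mat_pow M t) ** X ** mat_pow M t"
  have "transpose M ** suminf ?f ** M = (\<Sum>t. transpose M ** ?f t ** M)"
    by (rule bounded_linear.suminf[OF bounded_linear_congruence summable_congruence])
  also have "(\<lambda>t. transpose M ** ?f t ** M) = (\<lambda>t. ?f (Suc t))"
    by (simp add: mat_pow_Suc2 matrix_transpose_mul matrix_mul_assoc fun_eq_iff del: mat_pow.simps)
  also have "(\<Sum>t. ?f (Suc t)) = suminf ?f - X"
    using suminf_split_head[OF summable_congruence[of X]] by (simp add: transpose_mat del: mat_pow.simps(2))
  finally show ?thesis
    by simp
qed

text \<open>The difference of two solutions is unchanged by congruence with \<open>M\<close>, hence
  with all its powers, while these congruences tend to zero.\<close>

lemma lyapunov_unique: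
  assumes "transpose M ** P ** M - P + X = 0" "transpose M ** P' ** M - P' + X = 0"
  shows "P = P'"
proof -
  define D where "D = P - P'"
  have "transpose M ** P ** M = P - X" "transpose M ** P' ** M = P' - X"
    using assms by (simp_all add: algebra_simps)
  then have D: "transpose M ** D ** M = D"
    unfolding D_def linear_diff[OF bounded_linear.linear[OF bounded_linear_congruence]] by simp
  have "transpose (mat_pow M t) ** D ** mat_pow M t = D" for t
  proof (induction t)
    case (Suc t)
    have "transpose (mat_pow M (Suc t)) ** D ** mat_pow M (Suc t)
        = transpose (mat_pow M t) ** (transpose M ** D ** M) ** mat_pow M t"
      by (simp add: matrix_transpose_mul matrix_mul_assoc)
    then show ?case
      by (simp add: D Suc)
  qed (simp add: transpose_mat)
  then have "(\<lambda>t. D) \<longlonglongrightarrow> 0"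
    using summable_LIMSEQ_zero[OF summable_congruence[of D]] by simp
  then have "D = 0"
    by (simp add: LIMSEQ_const_iff)
  then show ?thesis
    by (simp add: D_def)
qed

lemma abs_output_le: "\<bar>(C *v (mat_pow M t *v v)) $ 1\<bar> \<le> norm C * K * norm v * r ^ t"
  for C :: "real^'n^1"
proof -
  have "\<bar>(C *v (mat_pow M t *v v)) $ 1\<bar> \<le> norm (C *v (mat_pow M t *v v))"
    using Finite_Cartesian_Product.norm_nth_le[of "C *v (mat_pow M t *v v)" 1] by simp
  also have "\<dots> \<le> norm C * (norm (mat_pow M t) * norm v)"
    by (intro order_trans[OF norm_matrix_vector_mult_le] mult_left_mono norm_matrix_vector_mult_le) simp
  also have "\<dots> \<le> norm C * (K * r ^ t * norm v)"
    by (intro mult_left_mono mult_right_mono growth) auto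
  finally show ?thesis
    by (simp add: mult_ac)
qed

text \<open>Used with \<open>v\<close> a component of the initial error, for the transient, and with
  \<open>v\<close> the column of \<open>B\<close>, for the impulse response. The explicit bound
  involves \<open>M\<close> only through \<open>K\<close> and \<open>r\<close>, so it is uniform in
  \<open>q\<close>.\<close>

lemma output_energy:
  fixes C :: "real^'n^1"
  shows "summable (\<lambda>t. ((C *v (mat_pow M t *v v)) $ 1)\<^sup>2)"
    and "(\<Sum>t. ((C *v (mat_pow M t *v v)) $ 1)\<^sup>2) \<le> (norm C * K * norm v)\<^sup>2 / (1 - r\<^sup>2)"
proof -
  have le: "((C *v (mat_pow M t *v v)) $ 1)\<^sup>2 \<le> (norm C * K * norm v)\<^sup>2 * (r\<^sup>2) ^ t" for t
    using power_mono[OF abs_output_le[of C t v], of 2]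
    by (simp add: power_mult_distrib power_mult[symmetric] mult.commute)
  have r2: "r\<^sup>2 < 1"
    using r by (simp add: power_less_one_iff)
  have s: "summable (\<lambda>t. (norm C * K * norm v)\<^sup>2 * (r\<^sup>2) ^ t)"
    using r2 by (intro summable_mult summable_geometric) simp
  show sum: "summable (\<lambda>t. ((C *v (mat_pow M t *v v)) $ 1)\<^sup>2)"
    by (rule summable_comparison_test'[OF s, of 0]) (use le in simp)
  have "(\<Sum>t. ((C *v (mat_pow M t *v v)) $ 1)\<^sup>2) \<le> (\<Sum>t. (norm C * K * norm v)\<^sup>2 * (r\<^sup>2) ^ t)"
    by (rule suminf_le[OF le sum s])
  also have "\<dots> = (norm C * K * norm v)\<^sup>2 / (1 - r\<^sup>2)"
    using r2 by (simp add: suminf_mult suminf_geometric summable_geometric)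
  finally show "(\<Sum>t. ((C *v (mat_pow M t *v v)) $ 1)\<^sup>2) \<le> (norm C * K * norm v)\<^sup>2 / (1 - r\<^sup>2)" .
qed

lemma lyapunov_series_energy:
  fixes C :: "real^'n^1" and B :: "real^1^'n"
  shows "(transpose B ** (\<Sum>t. transpose (mat_pow M t) ** (transpose C ** C) ** mat_pow M t) ** B) $ 1 $ 1
    = (\<Sum>t. ((C *v (mat_pow M t *v column 1 B)) $ 1)\<^sup>2)"
proof -
  let ?f = "\<lambda>t. transpose (mat_pow M t) ** (transpose C ** C) ** mat_pow M t"
  have "bounded_linear (\<lambda>X. (transpose B ** X ** B) $ 1 $ 1)"
    by (rule bounded_linear_compose[OF bounded_linear_vec_nth
          bounded_linear_compose[OF bounded_linear_vec_nth bounded_linear_congruence]])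
  then have "(transpose B ** suminf ?f ** B) $ 1 $ 1 = (\<Sum>t. (transpose B ** ?f t ** B) $ 1 $ 1)"
    by (rule bounded_linear.suminf[OF _ summable_congruence])
  also have "\<dots> = (\<Sum>t. ((C *v (mat_pow M t *v column 1 B)) $ 1)\<^sup>2)"
  proof -
    have "(transpose B ** ?f t ** B) $ 1 $ 1 = ((C *v (mat_pow M t *v column 1 B)) $ 1)\<^sup>2" for t
    proof -
      \<comment> \<open>A 1 x 1 matrix: each term of the conjugated series is
        \<open>transpose Z ** Z\<close>, the square of a scalar.\<close>
      define Z where "Z = C ** mat_pow M t ** B"
      have "transpose B ** ?f t ** B = transpose Z ** Z"
        by (simp add: Z_def matrix_transpose_mul matrix_mul_assoc)
      moreover have "Z $ 1 $ 1 = (C *v (mat_pow M t *v column 1 B)) $ 1"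
        by (simp add: Z_def matrix_vector_mul_assoc)
          (simp add: matrix_matrix_mult_def[of "C ** mat_pow M t"] matrix_vector_mult_def column_def)
      moreover have "(transpose Z ** Z) $ 1 $ 1 = (Z $ 1 $ 1)\<^sup>2"
        by (simp add: matrix_matrix_mult_def transpose_def power2_eq_square)
      ultimately show ?thesis
        by simp
    qed
    then show ?thesis
      by simp
  qed
  finally show ?thesis .
qed

end

lemma lyap_eq_solution:
  fixes A :: "real^'n^'n"
  assumes r: "0 < r" "r < 1"
    and growth: "\<And>t. norm (mat_pow (closed_loop A B C q) t) \<le> K * r ^ t"
  shows "\<exists>!P. lyap_eq A B C q P"
    and "(transpose B ** (THE P. lyap_eq A B C q P) ** B) $ 1 $ 1 = (\<Sum>k. (gain A B C q k)\<^sup>2)"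
proof -
  let ?M = "closed_loop A B C q"
  let ?P = "\<Sum>t. transpose (mat_pow ?M t) ** (transpose C ** C) ** mat_pow ?M t"
  have P: "lyap_eq A B C q ?P"
    unfolding lyap_eq_def by (rule lyapunov_series[OF r growth])
  moreover have unique: "P = ?P" if "lyap_eq A B C q P" for P
    using that P unfolding lyap_eq_def by (rule lyapunov_unique[OF r growth])
  ultimately show "\<exists>!P. lyap_eq A B C q P"
    by blast
  have "(THE P. lyap_eq A B C q P) = ?P"
    using P unique by (rule the_equality)
  then show "(transpose B ** (THE P. lyap_eq A B C q P) ** B) $ 1 $ 1 = (\<Sum>k. (gain A B C q k)\<^sup>2)"
    by (simp only: lyapunov_series_energy[OF r growth] gain_def)
qed

section \<open>Second moments\<close>

text \<open>The offset \<open>a\<close> stands for the deterministic effect of the initial state.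
  Zero mean removes the term linear in the noise; independence makes products at distinct times
  integrable with expectation zero.\<close>

lemma (in prob_space) second_moment_indep_sum:
  fixes X :: "nat \<Rightarrow> 'a \<Rightarrow> real"
  assumes indep: "indep_vars (\<lambda>_. borel) X UNIV"
    and int: "\<And>s. integrable M (X s)" and mean: "\<And>s. expectation (X s) = 0"
    and int2: "\<And>s. integrable M (\<lambda>x. (X s x)\<^sup>2)"
  shows "integrable M (\<lambda>x. (a + (\<Sum>s<n. X s x * g s))\<^sup>2)"
    and "expectation (\<lambda>x. (a + (\<Sum>s<n. X s x * g s))\<^sup>2) = a\<^sup>2 + (\<Sum>s<n. expectation (\<lambda>x. (X s x)\<^sup>2) * (g s)\<^sup>2)"
proof -
  have prod: "integrable M (\<lambda>x. X s x * X s' x) \<and>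
      expectation (\<lambda>x. X s x * X s' x) = (if s = s' then expectation (\<lambda>x. (X s x)\<^sup>2) else 0)" for s s'
  proof (cases "s = s'")
    case True
    then show ?thesis
      using int2[of s'] by (simp add: power2_eq_square)
  next
    case False
    have "indep_vars (\<lambda>_. borel) X {s, s'}"
      by (rule indep_vars_subset[OF indep]) simp
    then have "integrable M (\<lambda>x. \<Prod>i\<in>{s, s'}. X i x)"
      "expectation (\<lambda>x. \<Prod>i\<in>{s, s'}. X i x) = (\<Prod>i\<in>{s, s'}. expectation (X i))"
      by (intro indep_vars_integrable indep_vars_lebesgue_integral; simp add: int)+
    then show ?thesis
      using False by (simp add: mean)
  qed
  have expand: "(a + (\<Sum>s<n. X s x * g s))\<^sup>2
      = a\<^sup>2 + (\<Sum>s<n. X s x * (2 * a * g s)) + (\<Sum>s<n. \<Sum>s'<n. (X s x * X s' x) * (g s * g s'))" for x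
  proof -
    have "(\<Sum>s<n. X s x * g s)\<^sup>2 = (\<Sum>s<n. \<Sum>s'<n. (X s x * X s' x) * (g s * g s'))"
      by (simp add: power2_eq_square sum_product mult_ac)
    moreover have "2 * a * (\<Sum>s<n. X s x * g s) = (\<Sum>s<n. X s x * (2 * a * g s))"
      by (simp add: sum_distrib_left mult_ac)
    ultimately show ?thesis
      by (simp add: power2_sum)
  qed
  have "has_bochner_integral M (\<lambda>x. (a + (\<Sum>s<n. X s x * g s))\<^sup>2)
      (a\<^sup>2 + (\<Sum>s<n. 0 * (2 * a * g s))
        + (\<Sum>s<n. \<Sum>s'<n. (if s = s' then expectation (\<lambda>x. (X s x)\<^sup>2) else 0) * (g s * g s')))"
    unfolding expand
  proof (intro has_bochner_integral_add has_bochner_integral_sum has_bochner_integral_mult_left)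
    show "has_bochner_integral M (\<lambda>x. a\<^sup>2) (a\<^sup>2)"
      by (simp add: has_bochner_integral_iff prob_space)
    show "has_bochner_integral M (X s) 0" for s
      using int mean by (simp add: has_bochner_integral_iff)
    show "has_bochner_integral M (\<lambda>x. X s x * X s' x) (if s = s' then expectation (\<lambda>x. (X s x)\<^sup>2) else 0)" for s s'
      using prod unfolding has_bochner_integral_iff by blast
  qed
  then have "has_bochner_integral M (\<lambda>x. (a + (\<Sum>s<n. X s x * g s))\<^sup>2)
      (a\<^sup>2 + (\<Sum>s<n. expectation (\<lambda>x. (X s x)\<^sup>2) * (g s)\<^sup>2))"
    by (simp add: power2_eq_square if_distrib[of "\<lambda>x. x * _"] cong: if_cong)
  then show "integrable M (\<lambda>x. (a + (\<Sum>s<n. X s x * g s))\<^sup>2)"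
    and "expectation (\<lambda>x. (a + (\<Sum>s<n. X s x * g s))\<^sup>2) = a\<^sup>2 + (\<Sum>s<n. expectation (\<lambda>x. (X s x)\<^sup>2) * (g s)\<^sup>2)"
    by (simp_all add: has_bochner_integral_iff)
qed

text \<open>Projection to a fixed direction \<open>u\<close> preserves independence over time and
  zero mean. Nothing is claimed about components along different directions at the same time, which
  may be correlated.\<close>

lemma noise_laws_component:
  fixes P :: "(nat \<Rightarrow> real^'d^1) measure"
  assumes P: "P \<in> noise_laws \<sigma>"
  shows "prob_space P" "prob_space.indep_vars P (\<lambda>_. borel) (\<lambda>s w. w s $ 1 \<bullet> u) UNIV"
    "integrable P (\<lambda>w. w s $ 1 \<bullet> u)" "(\<integral>w. w s $ 1 \<bullet> u \<partial>P) = 0" "integrable P (\<lambda>w. (w s $ 1 \<bullet> u)\<^sup>2)"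
proof -
  show ps: "prob_space P"
    using P by (simp add: noise_laws_def)
  interpret prob_space P by (rule ps)
  have int: "integrable P (\<lambda>w. w t)" "(\<integral>w. w t \<partial>P) = 0" "integrable P (\<lambda>w. (norm (w t))\<^sup>2)" for t
    using P by (simp_all add: noise_laws_def)
  have lin: "bounded_linear (\<lambda>x :: real^'d^1. x $ 1 \<bullet> u)"
    by (rule bounded_linear_compose[OF bounded_linear_inner_left bounded_linear_vec_nth])
  have meas: "(\<lambda>x :: real^'d^1. x $ 1 \<bullet> u) \<in> borel_measurable borel"
    by (intro borel_measurable_continuous_onI linear_continuous_on lin)
  have "indep_vars (\<lambda>_. borel) (\<lambda>t w. w t) UNIV"
    using P by (simp add: noise_laws_def)
  then show "indep_vars (\<lambda>_. borel) (\<lambda>s w. w s $ 1 \<bullet> u) UNIV"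
    by (rule indep_vars_compose2) (rule meas)
  show i: "integrable P (\<lambda>w. w s $ 1 \<bullet> u)"
    by (rule integrable_bounded_linear[OF lin int(1)])
  show "(\<integral>w. w s $ 1 \<bullet> u \<partial>P) = 0"
    using integral_bounded_linear[OF lin int(1), of s] int(2)[of s] by simp
  show "integrable P (\<lambda>w. (w s $ 1 \<bullet> u)\<^sup>2)"
  proof (rule Bochner_Integration.integrable_bound)
    show "integrable P (\<lambda>w. (norm u)\<^sup>2 * (norm (w s))\<^sup>2)"
      by (intro integrable_mult_right int)
    show "(\<lambda>w. (w s $ 1 \<bullet> u)\<^sup>2) \<in> borel_measurable P"
      using i by (intro borel_measurable_power) auto
    have "(w s $ 1 \<bullet> u)\<^sup>2 \<le> (norm u)\<^sup>2 * (norm (w s))\<^sup>2" for w :: "nat \<Rightarrow> real^'d^1"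
    proof -
      have "\<bar>w s $ 1 \<bullet> u\<bar> \<le> norm (w s $ 1) * norm u"
        by (rule Cauchy_Schwarz_ineq2)
      also have "\<dots> \<le> norm (w s) * norm u"
        by (intro mult_right_mono Finite_Cartesian_Product.norm_nth_le) simp
      finally have "\<bar>w s $ 1 \<bullet> u\<bar>\<^sup>2 \<le> (norm (w s) * norm u)\<^sup>2"
        by (intro power_mono) auto
      then show ?thesis
        by (simp add: power_mult_distrib mult.commute)
    qed
    then show "AE w in P. norm ((w s $ 1 \<bullet> u)\<^sup>2) \<le> norm ((norm u)\<^sup>2 * (norm (w s))\<^sup>2)"
      by (intro AE_I2) (simp add: abs_mult)
  qed
qed

lemma expected_output_error:
  fixes A :: "real^'n^'n" and B :: "real^1^'n" and C :: "real^'n^1" and x0 :: "real^'d^'n"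
    and f :: "real^'d^1 \<Rightarrow> real" and P :: "(nat \<Rightarrow> real^'d^1) measure"
  assumes alg: "alg_form A C" and f: "f = quad_fun Q ystar fstar" "opt f = ystar" and Q: "transpose Q = Q"
    and S: "finite S" "pairwise orthogonal S" "\<And>u. u \<in> S \<Longrightarrow> norm u = 1" "span S = UNIV"
    and k: "\<And>u. u \<in> S \<Longrightarrow> Q *v u = k u *s u"
    and P: "P \<in> noise_laws \<sigma>"
  defines "a \<equiv> \<lambda>t u. (C *v (mat_pow (closed_loop A B C (k u)) t *v ((x0 - fixpt A C f) *v u))) $ 1"
  shows "integrable P (\<lambda>w. (norm (C ** state A B C f w x0 t - opt f))\<^sup>2)"
    and "(\<integral>w. (norm (C ** state A B C f w x0 t - opt f))\<^sup>2 \<partial>P)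
      = (\<Sum>u\<in>S. (a t u)\<^sup>2 + (\<Sum>s<t. (\<integral>w. (w s $ 1 \<bullet> u)\<^sup>2 \<partial>P) * (gain A B C (k u) (t - 1 - s))\<^sup>2))"
proof -
  have eq: "(norm (C ** state A B C f w x0 t - opt f))\<^sup>2
      = (\<Sum>u\<in>S. (a t u + (\<Sum>s<t. (w s $ 1 \<bullet> u) * gain A B C (k u) (t - 1 - s)))\<^sup>2)" for w
  proof -
    define e where "e t = state A B C f w x0 t - fixpt A C f" for t
    have "C ** state A B C f w x0 t - opt f = C ** e t"
      by (simp add: e_def bounded_bilinear.diff_right[OF bounded_bilinear_matrix_mult] fixpt[OF alg])
    moreover have "(norm (C ** e t *v u))\<^sup>2
        = (a t u + (\<Sum>s<t. (w s $ 1 \<bullet> u) * gain A B C (k u) (t - 1 - s)))\<^sup>2" if "u \<in> S" for u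
    proof -
      have "(norm (C ** e t *v u))\<^sup>2 = ((C *v (e t *v u)) $ 1)\<^sup>2"
        by (simp add: norm_vec_def[of "C ** e t *v u"] L2_set_def matrix_vector_mul_assoc)
      also have "e t *v u = mat_pow (closed_loop A B C (k u)) t *v (e 0 *v u)
          + (\<Sum>s<t. (w s $ 1 \<bullet> u) *\<^sub>R (mat_pow (closed_loop A B C (k u)) (t - 1 - s) *v column 1 B))"
        unfolding e_def by (rule state_error_eigen[OF alg f Q k[OF that]])
      also have "(C *v \<dots>) $ 1 = a t u + (\<Sum>s<t. (w s $ 1 \<bullet> u) * gain A B C (k u) (t - 1 - s))"
        by (simp add: matrix_vector_right_distrib matrix_vector_mult_sum_right matrix_vector_mult_scaleR
            a_def gain_def e_def)
      finally show ?thesis .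
    qed
    ultimately show ?thesis
      by (simp add: norm_sq_eq_sum_orthonormal[OF S])
  qed
  interpret prob_space P
    by (rule noise_laws_component(1)[OF P])
  note sm = second_moment_indep_sum[OF noise_laws_component(2,3,4,5)[OF P]]
  show "integrable P (\<lambda>w. (norm (C ** state A B C f w x0 t - opt f))\<^sup>2)"
    unfolding eq by (intro Bochner_Integration.integrable_sum sm(1))
  show "(\<integral>w. (norm (C ** state A B C f w x0 t - opt f))\<^sup>2 \<partial>P)
      = (\<Sum>u\<in>S. (a t u)\<^sup>2 + (\<Sum>s<t. (\<integral>w. (w s $ 1 \<bullet> u)\<^sup>2 \<partial>P) * (gain A B C (k u) (t - 1 - s))\<^sup>2))"
    unfolding eq by (subst Bochner_Integration.integral_sum) (simp_all add: sm)
qed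

text \<open>The variance budget: whatever is spent along one eigendirection is missing from the
  others.\<close>

lemma sum_noise_component_sq:
  fixes P :: "(nat \<Rightarrow> real^'d^1) measure"
  assumes S: "finite S" "pairwise orthogonal S" "\<And>u. u \<in> S \<Longrightarrow> norm u = 1" "span S = UNIV"
    and P: "P \<in> noise_laws \<sigma>"
  shows "(\<Sum>u\<in>S. \<integral>w. (w s $ 1 \<bullet> u)\<^sup>2 \<partial>P) = (\<integral>w. (norm (w s))\<^sup>2 \<partial>P)"
proof -
  have "(norm x)\<^sup>2 = (\<Sum>u\<in>S. (x $ 1 \<bullet> u)\<^sup>2)" for x :: "real^'d^1"
    using sum_inner_orthonormal_sq[OF S, of "x $ 1"] by (simp add: norm_vec_def[of x] L2_set_def)
  then show ?thesis
    using noise_laws_component(5)[OF P] by (simp add: Bochner_Integration.integral_sum)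
qed

section \<open>The sensitivity\<close>

text \<open>Exchanging the sums collects, for each \<open>s\<close>, the responses to the input
  \<open>b s\<close> within the horizon, which form a partial sum of the series of \<open>g\<close>.
  The input at the last time has not yet reached any output.\<close>

lemma sum_convolution_le:
  fixes b g :: "nat \<Rightarrow> real"
  assumes b: "\<And>s. 0 \<le> b s" and g: "\<And>k. 0 \<le> g k" "summable g"
  shows "(\<Sum>t<T. \<Sum>s<t. b s * g (t - 1 - s)) \<le> (\<Sum>s<T. b s) * suminf g"
proof (cases T)
  case (Suc n)
  have inner: "(\<Sum>i=Suc s..n. g (i - 1 - s)) \<le> suminf g" for s
  proof -
    have "inj_on (\<lambda>i. i - 1 - s) {Suc s..n}"
      by (auto simp: inj_on_def)
    then have "(\<Sum>i=Suc s..n. g (i - 1 - s)) = sum g ((\<lambda>i. i - 1 - s) ` {Suc s..n})"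
      by (simp add: sum.reindex)
    also have "\<dots> \<le> suminf g"
      using g by (intro sum_le_suminf) auto
    finally show ?thesis .
  qed
  have "(\<Sum>t<T. \<Sum>s<t. b s * g (t - 1 - s)) = (\<Sum>s<n. \<Sum>i=Suc s..n. b s * g (i - 1 - s))"
    unfolding Suc lessThan_Suc_atMost by (rule sum.nested_swap')
  also have "\<dots> \<le> (\<Sum>s<n. b s * suminf g)"
    unfolding sum_distrib_left[symmetric] by (intro sum_mono mult_left_mono inner b)
  also have "\<dots> \<le> (\<Sum>s<T. b s) * suminf g"
    unfolding sum_distrib_right[symmetric] Suc using b g
    by (intro mult_right_mono suminf_nonneg) auto
  finally show ?thesis .
qed simp

text \<open>Independent fair signs times a fixed vector of norm \<sigma>: the sign symmetry gives
  zero mean, and the norm is constant, so the variance budget is used up at every time.\<close>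

lemma noise_law_exists:
  assumes "0 < \<sigma>"
  obtains P :: "(nat \<Rightarrow> real^'d^1) measure"
  where "P \<in> noise_laws \<sigma>" "\<And>t. (\<integral>w. (norm (w t))\<^sup>2 \<partial>P) = \<sigma>\<^sup>2"
proof -
  define c :: "real^'d^1" where "c = axis 1 (axis undefined \<sigma>)"
  have c: "norm c = \<sigma>"
    using assms by (simp add: c_def norm_axis_eq)
  define D where "D = distr (measure_pmf (bernoulli_pmf (1/2))) borel (\<lambda>b. if b then c else - c)"
  have D: "prob_space D" "sets D = sets borel"
    by (auto simp: D_def intro!: measure_pmf.prob_space_distr)
  interpret D: prob_space D
    by (rule D)
  interpret product_prob_space "\<lambda>_ :: nat. D" UNIV
    by unfold_locales
  define P where "P = (\<Pi>\<^sub>M t\<in>(UNIV :: nat set). D)"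
  have sets: "sets P = sets (\<Pi>\<^sub>M t\<in>(UNIV :: nat set). borel)"
    unfolding P_def by (intro sets_PiM_cong) (auto simp: D)
  have rv: "(\<lambda>w. w t) \<in> P \<rightarrow>\<^sub>M borel" for t :: nat
  proof -
    have "(\<lambda>w. w t) \<in> P \<rightarrow>\<^sub>M D"
      unfolding P_def by (rule measurable_component_singleton) simp
    then show ?thesis
      unfolding measurable_cong_sets[OF refl D(2)] .
  qed
  have marginal: "distr P borel (\<lambda>w. w t) = D" for t :: nat
    using PiM_component[of t] distr_cong[OF refl D(2), of P "\<lambda>w. w t" "\<lambda>w. w t"] by (simp add: P_def)
  have int: "integrable P (\<lambda>w. f (w t)) \<and> (\<integral>w. f (w t) \<partial>P) = (1/2) *\<^sub>R f c + (1/2) *\<^sub>R f (- c)"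
    if f: "f \<in> borel_measurable borel" for f :: "_ \<Rightarrow> 'b::{banach, second_countable_topology}" and t
  proof -
    have "integrable D f"
      unfolding D_def using f
      by (subst integrable_distr_eq) (auto intro: integrable_measure_pmf_finite)
    moreover have "integral\<^sup>L D f = (1/2) *\<^sub>R f c + (1/2) *\<^sub>R f (- c)"
      unfolding D_def using f
      by (subst integral_distr) (auto simp: integral_measure_pmf[of UNIV] UNIV_bool)
    ultimately show ?thesis
      using integrable_distr_eq[OF rv f, of t] integral_distr[OF rv f, of t] by (simp add: marginal)
  qed
  have "prob_space P"
    unfolding P_def by (rule P.prob_space_axioms)
  moreover have "prob_space.indep_vars P (\<lambda>_. borel) (\<lambda>t w. w t) UNIV"
  proof -
    interpret P': prob_space P
      by fact
    have "distr P (\<Pi>\<^sub>M i\<in>UNIV. borel) (\<lambda>w. w) = P"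
      using distr_id2[OF sets[symmetric]] by simp
    then show ?thesis
      by (subst P'.indep_vars_iff_distr_eq_PiM) (simp_all add: rv marginal P_def[symmetric] restrict_def)
  qed
  moreover have "integrable P (\<lambda>w. w t) \<and> (\<integral>w. w t \<partial>P) = 0" for t
    using int[of "\<lambda>x. x" t] by simp
  moreover have "integrable P (\<lambda>w. (norm (w t))\<^sup>2) \<and> (\<integral>w. (norm (w t))\<^sup>2 \<partial>P) = \<sigma>\<^sup>2" for t
    using int[of "\<lambda>x. (norm x)\<^sup>2" t] c by simp
  ultimately show ?thesis
    using that[of P] sets by (simp add: noise_laws_def)
qed

text \<open>The witness \<open>q\<close> is the eigenvalue of \<open>Q\<close> with the largest
  impulse response energy, which exists since the eigenbasis is finite. The constant
  \<open>c\<close> carries the transient of the initial error and does not depend on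
  \<open>T\<close>.\<close>

lemma mean_output_error_upper:
  fixes A :: "real^'n^'n" and f :: "real^'d^1 \<Rightarrow> real" and P :: "(nat \<Rightarrow> real^'d^1) measure"
  assumes m: "0 < m" and alg: "alg_form A C" and f: "f \<in> quad_class m L"
    and P: "P \<in> noise_laws \<sigma>" and \<sigma>: "0 < \<sigma>"
    and r: "0 < r" "r < 1"
    and growth: "\<And>q t. q \<in> {m..L} \<Longrightarrow> norm (mat_pow (closed_loop A B C q) t) \<le> K * r ^ t"
  obtains c q where "q \<in> {m..L}"
    "\<And>T. 0 < T \<Longrightarrow> (\<integral>w. 1 / (\<sigma>\<^sup>2 * real T) *
       (\<Sum>t<T. (norm (C ** state A B C f w x0 t - opt f))\<^sup>2) \<partial>P) \<le> c / real T + (\<Sum>k. (gain A B C q k)\<^sup>2)"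
proof -
  obtain Q ystar fstar where f: "f = quad_fun Q ystar fstar" and Q: "transpose Q = Q" "eigenvals Q \<subseteq> {m..L}"
    using f by (auto simp: quad_class_altdef)
  have opt: "opt f = ystar"
    unfolding f by (rule opt_quad_fun[OF Q m])
  obtain S k where S: "finite S" "pairwise orthogonal S" "\<And>u. u \<in> S \<Longrightarrow> norm u = 1" "span S = UNIV"
    and k: "\<And>u. u \<in> S \<Longrightarrow> Q *v u = k u *s u" "\<And>u. u \<in> S \<Longrightarrow> k u \<in> eigenvals Q"
    using symmetric_matrix_eigenbasis[OF Q(1)] by blast
  define a where "a t u = (C *v (mat_pow (closed_loop A B C (k u)) t *v ((x0 - fixpt A C f) *v u))) $ 1" for t u
  define b where "b s u = (\<integral>w. (w s $ 1 \<bullet> u)\<^sup>2 \<partial>P)" for s u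
  define h where "h q = (\<Sum>k. (gain A B C q k)\<^sup>2)" for q
  note err = expected_output_error[OF alg f opt Q(1) S k(1) P, where B = B and ?x0.0 = x0, folded a_def b_def]
  have kmL: "k u \<in> {m..L}" if "u \<in> S" for u
    using k(2)[OF that] Q(2) by blast
  have b: "0 \<le> b s u" for s u
    by (simp add: b_def)
  have "(1 :: real^'d) \<in> span S"
    by (simp add: S(4))
  then have "S \<noteq> {}"
    by auto
  then obtain v where v: "v \<in> S" and max: "\<And>u. u \<in> S \<Longrightarrow> h (k u) \<le> h (k v)"
    using S(1) finite_imageI[of S "\<lambda>u. h (k u)"] Max_in[of "(\<lambda>u. h (k u)) ` S"] Max_ge[of "(\<lambda>u. h (k u)) ` S"]
    by fastforce
  define c where "c = (\<Sum>u\<in>S. \<Sum>t. (a t u)\<^sup>2)"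
  have bound: "(\<integral>w. 1 / (\<sigma>\<^sup>2 * real T) * (\<Sum>t<T. (norm (C ** state A B C f w x0 t - opt f))\<^sup>2) \<partial>P)
      \<le> (c / \<sigma>\<^sup>2) / real T + h (k v)" if T: "0 < T" for T
  proof -
    have sum_a: "(\<Sum>u\<in>S. \<Sum>t<T. (a t u)\<^sup>2) \<le> c"
      unfolding c_def a_def
      by (intro sum_mono sum_le_suminf output_energy[OF r growth] kmL) auto
    have "(\<Sum>u\<in>S. \<Sum>t<T. \<Sum>s<t. b s u * (gain A B C (k u) (t - 1 - s))\<^sup>2)
        \<le> (\<Sum>u\<in>S. (\<Sum>s<T. b s u) * h (k v))"
    proof (rule sum_mono)
      fix u assume u: "u \<in> S"
      have "(\<Sum>t<T. \<Sum>s<t. b s u * (gain A B C (k u) (t - 1 - s))\<^sup>2) \<le> (\<Sum>s<T. b s u) * h (k u)"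
        unfolding h_def gain_def
        by (intro sum_convolution_le b output_energy[OF r growth] kmL u) simp
      also have "\<dots> \<le> (\<Sum>s<T. b s u) * h (k v)"
        by (intro mult_left_mono max u sum_nonneg b)
      finally show "(\<Sum>t<T. \<Sum>s<t. b s u * (gain A B C (k u) (t - 1 - s))\<^sup>2) \<le> (\<Sum>s<T. b s u) * h (k v)" .
    qed
    \<comment> \<open>Once each energy is replaced by the largest one, the directions can be summed
      first, and the variance budget applies at each time.\<close>
    also have "\<dots> = (\<Sum>s<T. \<Sum>u\<in>S. b s u) * h (k v)"
      by (simp add: sum_distrib_right[symmetric] sum.swap[of _ S])
    also have "\<dots> \<le> (\<Sum>s<T. \<sigma>\<^sup>2) * h (k v)"
    proof (intro mult_right_mono sum_mono)
      show "(\<Sum>u\<in>S. b s u) \<le> \<sigma>\<^sup>2" for s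
        using sum_noise_component_sq[OF S P, of s] P by (simp add: b_def noise_laws_def)
      show "0 \<le> h (k v)"
        unfolding h_def gain_def by (intro suminf_nonneg output_energy[OF r growth] kmL v) simp
    qed
    finally have sum_b: "(\<Sum>u\<in>S. \<Sum>t<T. \<Sum>s<t. b s u * (gain A B C (k u) (t - 1 - s))\<^sup>2)
        \<le> real T * \<sigma>\<^sup>2 * h (k v)"
      by simp
    have "(\<integral>w. (\<Sum>t<T. (norm (C ** state A B C f w x0 t - opt f))\<^sup>2) \<partial>P)
        = (\<Sum>t<T. \<Sum>u\<in>S. (a t u)\<^sup>2 + (\<Sum>s<t. b s u * (gain A B C (k u) (t - 1 - s))\<^sup>2))"
      by (subst Bochner_Integration.integral_sum) (simp_all add: err)
    also have "\<dots> = (\<Sum>u\<in>S. \<Sum>t<T. (a t u)\<^sup>2)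
        + (\<Sum>u\<in>S. \<Sum>t<T. \<Sum>s<t. b s u * (gain A B C (k u) (t - 1 - s))\<^sup>2)"
      by (simp add: sum.distrib sum.swap[of _ "{..<T}"])
    also have "\<dots> \<le> c + real T * \<sigma>\<^sup>2 * h (k v)"
      by (intro add_mono sum_a sum_b)
    finally have "(\<integral>w. (\<Sum>t<T. (norm (C ** state A B C f w x0 t - opt f))\<^sup>2) \<partial>P) / (\<sigma>\<^sup>2 * real T)
        \<le> (c + real T * \<sigma>\<^sup>2 * h (k v)) / (\<sigma>\<^sup>2 * real T)"
      by (rule divide_right_mono) simp
    also have "\<dots> = (c / \<sigma>\<^sup>2) / real T + h (k v)"
      using T \<sigma> by (simp add: add_divide_distrib)
    finally show ?thesis
      by simp
  qed
  show ?thesis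
    by (rule that[OF kmL[OF v], of "c / \<sigma>\<^sup>2"]) (use bound in \<open>simp add: h_def\<close>)
qed

text \<open>All directions see the same \<open>q\<close>, so only the total variance counts, and
  starting at the fixed point leaves no transient. Dropping the first \<open>N\<close> times, each
  remaining one has expected energy at least \<sigma>^2 times the partial sum of length
  \<open>N\<close>.\<close>

lemma mean_output_error_lower:
  fixes A :: "real^'n^'n" and P :: "(nat \<Rightarrow> real^'d^1) measure"
  assumes alg: "alg_form A C" and P: "P \<in> noise_laws \<sigma>" and \<sigma>: "0 < \<sigma>"
    and var: "\<And>t. (\<integral>w. (norm (w t))\<^sup>2 \<partial>P) = \<sigma>\<^sup>2"
    and f: "f = quad_fun (mat q) 0 0" "opt f = 0" and T: "N \<le> T" "0 < T"
  shows "(1 - real N / real T) * (\<Sum>k<N. (gain A B C q k)\<^sup>2)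
    \<le> (\<integral>w. 1 / (\<sigma>\<^sup>2 * real T) *
       (\<Sum>t<T. (norm (C ** state A B C f w (fixpt A C f) t - opt f))\<^sup>2) \<partial>P)"
proof -
  obtain S where S: "finite S" "pairwise orthogonal S" "\<And>u. u \<in> S \<Longrightarrow> norm u = 1" "span S = (UNIV :: (real^'d) set)"
    \<comment> \<open>The zero matrix merely serves to produce some orthonormal basis; each of its
      members is an eigenvector of \<open>mat q\<close>.\<close>
    using symmetric_matrix_eigenbasis[OF transpose_mat_scalar[of 0]] by metis
  define G where "G n = (\<Sum>k<n. (gain A B C q k)\<^sup>2)" for n
  note err = expected_output_error[OF alg f transpose_mat_scalar S mat_vector_mult P,
      where B = B and ?x0.0 = "fixpt A C f"]
  have E: "(\<integral>w. (norm (C ** state A B C f w (fixpt A C f) t - opt f))\<^sup>2 \<partial>P) = \<sigma>\<^sup>2 * G t" for t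
  proof -
    have "(\<integral>w. (norm (C ** state A B C f w (fixpt A C f) t - opt f))\<^sup>2 \<partial>P)
        = (\<Sum>u\<in>S. \<Sum>s<t. (\<integral>w. (w s $ 1 \<bullet> u)\<^sup>2 \<partial>P) * (gain A B C q (t - 1 - s))\<^sup>2)"
      by (simp add: err)
    also have "\<dots> = (\<Sum>s<t. (\<Sum>u\<in>S. \<integral>w. (w s $ 1 \<bullet> u)\<^sup>2 \<partial>P) * (gain A B C q (t - 1 - s))\<^sup>2)"
      by (simp add: sum_distrib_right sum.swap[of _ S])
    also have "\<dots> = \<sigma>\<^sup>2 * (\<Sum>s<t. (gain A B C q (t - Suc s))\<^sup>2)"
      by (simp add: sum_noise_component_sq[OF S P] var sum_distrib_left)
    also have "(\<Sum>s<t. (gain A B C q (t - Suc s))\<^sup>2) = G t"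
      unfolding G_def by (rule sum.nat_diff_reindex)
    finally show ?thesis .
  qed
  have "(real T - real N) * G N = (\<Sum>t\<in>{N..<T}. G N)"
    using T by (simp add: of_nat_diff)
  also have "\<dots> \<le> (\<Sum>t\<in>{N..<T}. G t)"
    unfolding G_def by (intro sum_mono sum_mono2) auto
  also have "\<dots> \<le> (\<Sum>t<T. G t)"
    unfolding G_def by (intro sum_mono2 sum_nonneg) auto
  finally have le: "(real T - real N) * G N \<le> (\<Sum>t<T. G t)" .
  have "(\<integral>w. 1 / (\<sigma>\<^sup>2 * real T) * (\<Sum>t<T. (norm (C ** state A B C f w (fixpt A C f) t - opt f))\<^sup>2) \<partial>P)
      = 1 / (\<sigma>\<^sup>2 * real T) * (\<Sum>t<T. \<sigma>\<^sup>2 * G t)"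
    by (subst integral_mult_right_zero, subst Bochner_Integration.integral_sum) (simp_all only: err(1) E)
  also have "\<dots> = (\<Sum>t<T. G t) / real T"
    using \<sigma> by (simp add: sum_distrib_left[symmetric])
  also have "\<dots> \<ge> (real T - real N) * G N / real T"
    using le by (rule divide_right_mono) simp
  finally have "(real T - real N) * G N / real T
      \<le> (\<integral>w. 1 / (\<sigma>\<^sup>2 * real T) * (\<Sum>t<T. (norm (C ** state A B C f w (fixpt A C f) t - opt f))\<^sup>2) \<partial>P)" .
  moreover have "(1 - real N / real T) * G N = (real T - real N) * G N / real T"
    using T by (simp add: field_simps)
  ultimately show ?thesis
    by (simp only: G_def)
qed

lemma sens_quad_class_le:
  fixes A :: "real^'n^'n"
  assumes m: "0 < m" and alg: "alg_form A C" and \<sigma>: "0 < \<sigma>" and r: "0 < r" "r < 1"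
    and growth: "\<And>q t. q \<in> {m..L} \<Longrightarrow> norm (mat_pow (closed_loop A B C q) t) \<le> K * r ^ t"
  shows "sens \<sigma> A B C (quad_class m L :: (real^'d^1 \<Rightarrow> real) set)
    \<le> (SUP q \<in> {m..L}. ereal (sqrt (\<Sum>k. (gain A B C q k)\<^sup>2)))"
  unfolding sens_def
proof (intro SUP_least)
  fix f :: "real^'d^1 \<Rightarrow> real" and x0 and P :: "(nat \<Rightarrow> real^'d^1) measure"
  assume f: "f \<in> quad_class m L" and P: "P \<in> noise_laws \<sigma>"
  let ?E = "\<lambda>T. \<integral>w. 1 / (\<sigma>\<^sup>2 * real T) * (\<Sum>t<T. (norm (C ** state A B C f w x0 t - opt f))\<^sup>2) \<partial>P"
  obtain c q where q: "q \<in> {m..L}" and E: "\<And>T. 0 < T \<Longrightarrow> ?E T \<le> c / real T + (\<Sum>k. (gain A B C q k)\<^sup>2)"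
    using mean_output_error_upper[OF m alg f P \<sigma> r growth, where ?x0.0 = x0] by metis
  have "limsup (\<lambda>T. ereal (sqrt (?E T))) \<le> limsup (\<lambda>T. ereal (sqrt (c / real T + (\<Sum>k. (gain A B C q k)\<^sup>2))))"
  proof (rule Limsup_mono)
    show "\<forall>\<^sub>F T in sequentially. ereal (sqrt (?E T)) \<le> ereal (sqrt (c / real T + (\<Sum>k. (gain A B C q k)\<^sup>2)))"
      using eventually_gt_at_top[of 0] by eventually_elim (use E in simp)
  qed
  also have "\<dots> = ereal (sqrt (0 + (\<Sum>k. (gain A B C q k)\<^sup>2)))"
    by (intro lim_imp_Limsup tendsto_ereal tendsto_real_sqrt tendsto_add lim_const_over_n tendsto_const) simp
  also have "\<dots> \<le> (SUP q \<in> {m..L}. ereal (sqrt (\<Sum>k. (gain A B C q k)\<^sup>2)))"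
    by (rule SUP_upper2[OF q]) simp
  finally show "limsup (\<lambda>T. ereal (sqrt (?E T))) \<le> (SUP q \<in> {m..L}. ereal (sqrt (\<Sum>k. (gain A B C q k)\<^sup>2)))" .
qed

text \<open>The truncation \<open>N\<close> is fixed while \<open>T\<close> tends to infinity, so
  the lost fraction \<open>N / T\<close> vanishes. The limit in \<open>N\<close> is taken
  afterwards, once summability is at hand.\<close>

lemma sens_quad_class_ge:
  fixes A :: "real^'n^'n"
  assumes m: "0 < m" and alg: "alg_form A C" and \<sigma>: "0 < \<sigma>" and q: "q \<in> {m..L}"
  shows "ereal (sqrt (\<Sum>k<N. (gain A B C q k)\<^sup>2)) \<le> sens \<sigma> A B C (quad_class m L :: (real^'d^1 \<Rightarrow> real) set)"
proof -
  define f :: "real^'d^1 \<Rightarrow> real" where "f = quad_fun (mat q) 0 0"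
  have opt: "opt f = 0"
    unfolding f_def using q by (intro opt_quad_fun[OF transpose_mat_scalar _ m, of _ L] order_trans[OF eigenvals_mat]) simp
  obtain P :: "(nat \<Rightarrow> real^'d^1) measure"
    where P: "P \<in> noise_laws \<sigma>" and var: "\<And>t. (\<integral>w. (norm (w t))\<^sup>2 \<partial>P) = \<sigma>\<^sup>2"
    using noise_law_exists[OF \<sigma>] by blast
  let ?E = "\<lambda>T. \<integral>w. 1 / (\<sigma>\<^sup>2 * real T) *
    (\<Sum>t<T. (norm (C ** state A B C f w (fixpt A C f) t - opt f))\<^sup>2) \<partial>P"
  let ?G = "\<Sum>k<N. (gain A B C q k)\<^sup>2"
  have "ereal (sqrt ((1 - 0) * ?G)) = limsup (\<lambda>T. ereal (sqrt ((1 - real N / real T) * ?G)))"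
    by (intro lim_imp_Limsup[symmetric] tendsto_ereal tendsto_real_sqrt tendsto_mult tendsto_diff
        lim_const_over_n tendsto_const) simp
  also have "\<dots> \<le> limsup (\<lambda>T. ereal (sqrt (?E T)))"
  proof (rule Limsup_mono)
    show "\<forall>\<^sub>F T in sequentially. ereal (sqrt ((1 - real N / real T) * ?G)) \<le> ereal (sqrt (?E T))"
      using eventually_ge_at_top[of "Suc N"]
      by eventually_elim (use mean_output_error_lower[OF alg P \<sigma> var f_def opt] in simp)
  qed
  also have "\<dots> \<le> sens \<sigma> A B C (quad_class m L :: (real^'d^1 \<Rightarrow> real) set)"
    unfolding sens_def
    by (rule SUP_upper2[of f], simp add: f_def quad_fun_mat_in_quad_class[OF q],
        rule SUP_upper2[of "fixpt A C f"], simp, rule SUP_upper2[OF P], simp)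
  finally show ?thesis
    by simp
qed

lemma sens_quad_class:
  fixes A :: "real^'n^'n"
  assumes m: "0 < m" and alg: "alg_form A C" and \<sigma>: "0 < \<sigma>" and r: "0 < r" "r < 1"
    and growth: "\<And>q t. q \<in> {m..L} \<Longrightarrow> norm (mat_pow (closed_loop A B C q) t) \<le> K * r ^ t"
  shows "sens \<sigma> A B C (quad_class m L :: (real^'d^1 \<Rightarrow> real) set)
    = (SUP q \<in> {m..L}. ereal (sqrt (\<Sum>k. (gain A B C q k)\<^sup>2)))" (is "?sens = _")
proof (rule antisym)
  show "?sens \<le> (SUP q \<in> {m..L}. ereal (sqrt (\<Sum>k. (gain A B C q k)\<^sup>2)))"
    by (rule sens_quad_class_le[OF assms])
  show "(SUP q \<in> {m..L}. ereal (sqrt (\<Sum>k. (gain A B C q k)\<^sup>2))) \<le> ?sens"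
  proof (rule SUP_least)
    fix q assume q: "q \<in> {m..L}"
    have "summable (\<lambda>k. (gain A B C q k)\<^sup>2)"
      unfolding gain_def by (rule output_energy[OF r growth[OF q]])
    then have "(\<lambda>N. ereal (sqrt (\<Sum>k<N. (gain A B C q k)\<^sup>2))) \<longlonglongrightarrow> ereal (sqrt (\<Sum>k. (gain A B C q k)\<^sup>2))"
      by (intro tendsto_ereal tendsto_real_sqrt summable_LIMSEQ)
    then show "ereal (sqrt (\<Sum>k. (gain A B C q k)\<^sup>2)) \<le> ?sens"
      by (rule LIMSEQ_le_const2) (use sens_quad_class_ge[OF m alg \<sigma> q] in blast)
  qed
qed

theorem lemma3p1:
  fixes A :: "real^'n^'n" and B :: "real^1^'n" and C :: "real^'n^1"
    and m L \<sigma> :: real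
  assumes "0 < m" and "m \<le> L" and "0 < \<sigma>" and "alg_form A C"
  shows "rate A B C (quad_class m L :: (real^'d^1 \<Rightarrow> real) set)
           = (SUP q \<in> {m..L}. ereal (spec_radius (A + q *\<^sub>R (B ** C))))
    \<and> (rate A B C (quad_class m L :: (real^'d^1 \<Rightarrow> real) set) < 1 \<longrightarrow>
         (\<forall>q \<in> {m..L}. \<exists>!P. lyap_eq A B C q P) \<and>
         sens \<sigma> A B C (quad_class m L :: (real^'d^1 \<Rightarrow> real) set) < \<infinity> \<and>
         sens \<sigma> A B C (quad_class m L :: (real^'d^1 \<Rightarrow> real) set)
           = (SUP q \<in> {m..L}.
                ereal (sqrt ((transpose B ** (THE P. lyap_eq A B C q P) ** B) $ 1 $ 1))))"
proof (intro conjI impI)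
  show "rate A B C (quad_class m L :: (real^'d^1 \<Rightarrow> real) set)
      = (SUP q \<in> {m..L}. ereal (spec_radius (A + q *\<^sub>R (B ** C))))"
    by (rule rate_quad_class[OF assms(1,2,4)])
next
  assume "rate A B C (quad_class m L :: (real^'d^1 \<Rightarrow> real) set) < 1"
  then obtain r K where r: "0 < r" "r < 1"
    and growth: "\<And>q t. q \<in> {m..L} \<Longrightarrow> norm (mat_pow (closed_loop A B C q) t) \<le> K * r ^ t"
    using growth_of_rate_less_1[OF assms(1,4)] by metis
  show "\<forall>q \<in> {m..L}. \<exists>!P. lyap_eq A B C q P"
    using lyap_eq_solution(1)[OF r growth] by blast
  have sens: "sens \<sigma> A B C (quad_class m L :: (real^'d^1 \<Rightarrow> real) set)
      = (SUP q \<in> {m..L}. ereal (sqrt (\<Sum>k. (gain A B C q k)\<^sup>2)))"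
    by (rule sens_quad_class[OF assms(1,4,3) r growth])
  also have "\<dots> = (SUP q \<in> {m..L}. ereal (sqrt ((transpose B ** (THE P. lyap_eq A B C q P) ** B) $ 1 $ 1)))"
    by (intro SUP_cong refl) (simp only: lyap_eq_solution(2)[OF r growth])
  finally show "sens \<sigma> A B C (quad_class m L :: (real^'d^1 \<Rightarrow> real) set)
      = (SUP q \<in> {m..L}. ereal (sqrt ((transpose B ** (THE P. lyap_eq A B C q P) ** B) $ 1 $ 1)))" .
  \<comment> \<open>Finiteness of the supremum needs more than finiteness for each \<open>q\<close>:
    the energy bound depends only on the common constants \<open>K\<close> and
    \<open>r\<close>.\<close>
  have "(SUP q \<in> {m..L}. ereal (sqrt (\<Sum>k. (gain A B C q k)\<^sup>2)))
      \<le> ereal (sqrt ((norm C * K * norm (column 1 B))\<^sup>2 / (1 - r\<^sup>2)))"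
    unfolding gain_def
    by (intro SUP_least) (simp only: ereal_less_eq real_sqrt_le_iff output_energy(2)[OF r growth])
  then show "sens \<sigma> A B C (quad_class m L :: (real^'d^1 \<Rightarrow> real) set) < \<infinity>"
    unfolding sens by (rule order_le_less_trans) simp
qed

end
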